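(* Let $N\ge1$ be an integer, $\beta$ a positive integer and $\omega>0$ a real number. For each superpartition $\Lambda$ with $N$ entries let $m_\Lambda^\omega=e^{-\frac1{4\omega}\Delta}m_\Lambda$ and $p_\Lambda^\omega=e^{-\frac1{4\omega}\Delta}p_\Lambda$. Then the set $\{m_\Lambda^\omega\}_\Lambda$ is the unique basis of $P^{S_N}$ (indexed by superpartitions) such that $$\mathcal H_1^\omega m_\Lambda^\omega=|\Lambda|\,m_\Lambda^\omega\qquad\text{and}\qquad m_\Lambda^\omega=m_\Lambda+\sum_{\Omega<_u\Lambda}y_{\Lambda\Omega}(\beta,\omega,N)\,m_\Omega$$ for some coefficients $y_{\Lambda\Omega}(\beta,\omega,N)$. Similarly, $\{p_\Lambda^\omega\}_\Lambda$ is the only basis of $P^{S_N}$ (indexed by superpartitions) such that $$\mathcal H_1^\omega p_\Lambda^\omega=|\Lambda|\,p_\Lambda^\omega\qquad\text{and}\qquad p_\Lambda^\omega=p_\Lambda+\sum_{\Omega<_u\Lambda}z_{\Lambda\Omega}(\beta,\omega,N)\,p_\Omega$$ for some coefficients $z_{\Lambda\Omega}(\beta,\omega,N)$.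
   Context: **Superpolynomials.** A superpolynomial is an element of the algebra generated by commuting variables $x_1,\ldots,x_N$ and anticommuting variables $\theta_1,\ldots,\theta_N$ ($\theta_i\theta_j=-\theta_j\theta_i$, $\theta_i^2=0$), with complex coefficients. $x_{ij}=x_i-x_j$, $\partial_i=\partial/\partial x_i$. $K_{ij}$ exchanges $x_i,x_j$; $\kappa_{ij}$ exchanges $\theta_i,\theta_j$; $\mathcal K_{ij}=\kappa_{ij}K_{ij}$; for $w\in S_N$, $\mathcal K_w$ is the corresponding product of $\mathcal K_{i,i+1}$'s (simultaneous permutation of the $x$'s and $\theta$'s). $P^{S_N}$ is the space of symmetric superpolynomials: those $f$ with $\mathcal K_{ij}f=f$ for all $i,j$. **Superpartitions.** A superpartition (with $N$ entries, fermion number $m$, $0\le m\le N$) is $\Lambda=(\Lambda_1,\ldots,\Lambda_m;\Lambda_{m+1},\ldots,\Lambda_N)$ with nonnegative integers, $\Lambda_1>\cdots>\Lambda_m\ge0$ and $\Lambda_{m+1}\ge\cdots\ge\Lambda_N\ge0$. Its degree is $|\Lambda|=\sum_i\Lambda_i$. The $u$-ordering: $\Omega\le_u\Lambda$ if either $\Omega=\Lambda$ or $|\Omega|=|\Lambda|-2n$ for some $n\in\{1,2,3,\ldots\}$. **Monomials and power sums.** $m_\Lambda=\frac{1}{f_\Lambda}\sum_{\sigma\in S_N}\mathcal K_\sigma(\theta_1\cdots\theta_m x_1^{\Lambda_1}\cdots x_N^{\Lambda_N})$, with $f_\Lambda=\prod_{i\ge0}n(i)!$, $n(i)$ being the number of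 entries equal to $i$ in $(\Lambda_{m+1},\ldots,\Lambda_N)$. Further, $p_\Lambda=q_{\Lambda_1}\cdots q_{\Lambda_m}\,p_{\Lambda_{m+1}}\cdots p_{\Lambda_N}$, where $p_n=\sum_ix_i^n$ for $n\ge1$, $p_0=1$, and $q_n=\sum_i\theta_ix_i^n$ for $n\ge0$. Both $\{m_\Lambda\}$ and $\{p_\Lambda\}$ are bases of $P^{S_N}$. **Operators.** With the rational Dunkl operators $D_j=\partial_j+\beta\sum_{k\ne j}\frac1{x_{jk}}(1-K_{jk})$, set $\Delta=\sum_{j=1}^ND_j^2$ (it lowers the degree in $x$ by $2$ and preserves $P^{S_N}$, so $e^{\pm\frac1{4\omega}\Delta}$ acts on each superpolynomial as a finite sum). The first rational conserved operator is $$\mathcal H_1^\omega=e^{-\frac1{4\omega}\Delta}\Big(\sum_{j=1}^Nx_j\partial_j\Big)e^{\frac1{4\omega}\Delta}$$ acting on $P^{S_N}$. *)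

theory Defs
  imports
    Complex_Main
    "HOL-Library.Poly_Mapping"
    "HOL-Library.FSet"
    "HOL-Combinatorics.Permutations"
begin

section \<open>Polynomials in the commuting variables\<close>

text \<open>
  Polynomials in \<open>x\<^sub>1, x\<^sub>2, \<dots>\<close>: a monomial is its exponent vector, and the product is
  convolution, so this type is an integral domain. The number \<open>N\<close> of variables is imposed
  by \<open>superpolys\<close> below.
\<close>

type_synonym xpoly = "(nat \<Rightarrow>\<^sub>0 nat) \<Rightarrow>\<^sub>0 complex"

definition cst :: "complex \<Rightarrow> xpoly" where
  "cst c = Poly_Mapping.single 0 c"

definition X :: "nat \<Rightarrow> xpoly" where
  "X i = Poly_Mapping.single (Poly_Mapping.single i 1) 1"

definition x_subst :: "(nat \<Rightarrow> nat) \<Rightarrow> xpoly \<Rightarrow> xpoly" where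
  "x_subst \<sigma> p =
     (\<Sum>e\<in>Poly_Mapping.keys p. cst (Poly_Mapping.lookup p e) *
        (\<Prod>i\<in>Poly_Mapping.keys e. X (\<sigma> i) ^ Poly_Mapping.lookup e i))"

definition x_deriv :: "nat \<Rightarrow> xpoly \<Rightarrow> xpoly" where
  "x_deriv j p =
     (\<Sum>e\<in>Poly_Mapping.keys p. Poly_Mapping.single (e - Poly_Mapping.single j 1)
                    (of_nat (Poly_Mapping.lookup e j) * Poly_Mapping.lookup p e))"

text \<open>
  The operator \<open>(1 - K\<^sub>j\<^sub>k) / x\<^sub>j\<^sub>k\<close>, the quotient being the exact one in the polynomial ring;
  lemma \<open>swap_quot_ex1\<close> below shows that it is well defined for \<open>j \<noteq> k\<close>.
\<close>

definition swap_quot :: "nat \<Rightarrow> nat \<Rightarrow> xpoly \<Rightarrow> xpoly" where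
  "swap_quot j k p = (THE q. (X j - X k) * q = p - x_subst (transpose j k) p)"

definition dunkl :: "nat \<Rightarrow> nat \<Rightarrow> nat \<Rightarrow> xpoly \<Rightarrow> xpoly" where
  "dunkl N \<beta> j p = x_deriv j p + of_nat \<beta> * (\<Sum>k\<in>{1..N} - {j}. swap_quot j k p)"

definition x_euler :: "nat \<Rightarrow> xpoly \<Rightarrow> xpoly" where
  "x_euler N p = (\<Sum>j=1..N. X j * x_deriv j p)"


lemma X_diff_neq_0:
  assumes "j \<noteq> k"
  shows "X j - X k \<noteq> 0"
proof -
  have "Poly_Mapping.single k (1::nat) \<noteq> Poly_Mapping.single j 1"
    using assms by (metis lookup_single_eq lookup_single_not_eq zero_neq_one)
  then have "Poly_Mapping.lookup (X j - X k) (Poly_Mapping.single j 1) = 1"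
    by (simp add: X_def lookup_minus lookup_single_not_eq)
  then show ?thesis by auto
qed

lemma pow_diff_dvd: "a - b dvd a ^ n - (b::'a::comm_ring_1) ^ n"
  by (simp add: power_diff_sumr2)

lemma diff_dvd_swap_monom:
  fixes x :: "nat \<Rightarrow> 'a::comm_ring_1"
  assumes "finite A"
  shows "x j - x k dvd (\<Prod>i\<in>A. x i ^ n i) - (\<Prod>i\<in>A. x (transpose j k i) ^ n i)"
  using assms
proof (induction A rule: finite_induct)
  case empty
  then show ?case by simp
next
  case (insert a A)
  have 1: "x j - x k dvd x a ^ n a - x (transpose j k a) ^ n a"
  proof -
    have "x j - x k dvd x a - x (transpose j k a)"
      using dvd_minus_iff[of "x j - x k" "x j - x k"]
      by (cases "a = j \<or> a = k") auto
    then show ?thesis using pow_diff_dvd dvd_trans by blast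
  qed
  have 2: "(\<Prod>i\<in>insert a A. x i ^ n i) - (\<Prod>i\<in>insert a A. x (transpose j k i) ^ n i)
    = (x a ^ n a - x (transpose j k a) ^ n a) * (\<Prod>i\<in>A. x i ^ n i)
      + x (transpose j k a) ^ n a * ((\<Prod>i\<in>A. x i ^ n i) - (\<Prod>i\<in>A. x (transpose j k i) ^ n i))"
    using insert by (simp add: algebra_simps)
  show ?case
    unfolding 2 by (rule dvd_add[OF dvd_mult2[OF 1] dvd_mult[OF insert.IH]])
qed

lemma X_power: "X i ^ n = Poly_Mapping.single (Poly_Mapping.single i n) 1"
  by (induction n) (simp_all add: X_def mult_single single_add[symmetric])

lemma prod_single_one:
  "finite A \<Longrightarrow> (\<Prod>i\<in>A. Poly_Mapping.single (f i) 1 :: xpoly) = Poly_Mapping.single (\<Sum>i\<in>A. f i) 1"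
  by (induction A rule: finite_induct) (simp_all add: mult_single)

lemma sum_single: "(\<Sum>e\<in>Poly_Mapping.keys p. Poly_Mapping.single e (Poly_Mapping.lookup p e)) = p"
  by (rule poly_mapping_eqI)
    (simp add: lookup_sum lookup_single when_def in_keys_iff)

lemma x_subst_id: "x_subst (\<lambda>i. i) p = p"
proof -
  have "cst (Poly_Mapping.lookup p e) * (\<Prod>i\<in>Poly_Mapping.keys e. X i ^ Poly_Mapping.lookup e i)
    = Poly_Mapping.single e (Poly_Mapping.lookup p e)" for e
    by (simp add: X_power prod_single_one sum_single cst_def mult_single)
  then show ?thesis by (simp add: x_subst_def sum_single)
qed

lemma swap_quot_ex1:
  assumes "j \<noteq> k"
  shows "\<exists>!q. (X j - X k) * q = p - x_subst (transpose j k) p"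
proof -
  have "p - x_subst (transpose j k) p = x_subst (\<lambda>i. i) p - x_subst (transpose j k) p"
    by (simp add: x_subst_id)
  also have "\<dots> = (\<Sum>e\<in>Poly_Mapping.keys p. cst (Poly_Mapping.lookup p e) *
      ((\<Prod>i\<in>Poly_Mapping.keys e. X i ^ Poly_Mapping.lookup e i)
        - (\<Prod>i\<in>Poly_Mapping.keys e. X (transpose j k i) ^ Poly_Mapping.lookup e i)))"
    by (simp add: x_subst_def right_diff_distrib sum_subtractf)
  also have "X j - X k dvd \<dots>"
    by (intro dvd_sum dvd_mult diff_dvd_swap_monom) simp
  finally obtain q where q: "p - x_subst (transpose j k) p = (X j - X k) * q" ..
  show ?thesis
  proof (rule ex1I)
    show "(X j - X k) * q = p - x_subst (transpose j k) p" using q by simp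
  next
    fix q'
    assume "(X j - X k) * q' = p - x_subst (transpose j k) p"
    then have "(X j - X k) * q' = (X j - X k) * q" using q by simp
    then show "q' = q" using X_diff_neq_0[OF assms] by simp
  qed
qed


section \<open>The algebra of superpolynomials\<close>

text \<open>
  The value at \<open>I = {i\<^sub>1 < \<dots> < i\<^sub>r}\<close> is the coefficient of \<open>\<theta>\<^sub>i\<^sub>1 \<dots> \<theta>\<^sub>i\<^sub>r\<close>.
\<close>

typedef superpoly = "{f :: nat fset \<Rightarrow> xpoly. finite {I. f I \<noteq> 0}}"
  morphisms coef Abs_superpoly
  by (rule exI[of _ "\<lambda>_. 0"]) simp

setup_lifting type_definition_superpoly
lifting_forget poly_mapping.lifting

text \<open>
  For disjoint \<open>I\<close> and \<open>J\<close>, sorting \<open>\<theta>\<^sub>I \<theta>\<^sub>J\<close> takes one transposition of adjacent factors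
  for each pair \<open>i \<in> I\<close>, \<open>j \<in> J\<close> with \<open>j < i\<close>.
\<close>

definition theta_sign :: "nat fset \<Rightarrow> nat fset \<Rightarrow> xpoly" where
  "theta_sign I J = (- 1) ^ card {(i, j) \<in> fset I \<times> fset J. j < i}"

lemma theta_sign_empty [simp]: "theta_sign {||} J = 1" "theta_sign I {||} = 1"
  by (simp_all add: theta_sign_def)

lemma theta_sign_union_left:
  assumes "I |\<inter>| J = {||}"
  shows "theta_sign (I |\<union>| J) M = theta_sign I M * theta_sign J M"
proof -
  have fin: "finite {(i, j) \<in> fset A \<times> fset B. j < i}" for A B :: "nat fset"
    by (rule finite_subset[of _ "fset A \<times> fset B"]) auto
  have d: "fset I \<inter> fset J = {}" using assms by (metis bot_fset.rep_eq inf_fset.rep_eq)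
  have "{(i, j) \<in> fset (I |\<union>| J) \<times> fset M. j < i}
      = {(i, j) \<in> fset I \<times> fset M. j < i} \<union> {(i, j) \<in> fset J \<times> fset M. j < i}"
    by auto
  also have "card \<dots> = card {(i, j) \<in> fset I \<times> fset M. j < i} + card {(i, j) \<in> fset J \<times> fset M. j < i}"
    by (rule card_Un_disjoint) (use fin d in auto)
  finally show ?thesis by (simp add: theta_sign_def power_add)
qed

lemma theta_sign_union_right:
  assumes "J |\<inter>| M = {||}"
  shows "theta_sign I (J |\<union>| M) = theta_sign I J * theta_sign I M"
proof -
  have fin: "finite {(i, j) \<in> fset A \<times> fset B. j < i}" for A B :: "nat fset"
    by (rule finite_subset[of _ "fset A \<times> fset B"]) auto
  have d: "fset J \<inter> fset M = {}" using assms by (metis bot_fset.rep_eq inf_fset.rep_eq)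
  have "{(i, j) \<in> fset I \<times> fset (J |\<union>| M). j < i}
      = {(i, j) \<in> fset I \<times> fset J. j < i} \<union> {(i, j) \<in> fset I \<times> fset M. j < i}"
    by auto
  also have "card \<dots> = card {(i, j) \<in> fset I \<times> fset J. j < i} + card {(i, j) \<in> fset I \<times> fset M. j < i}"
    by (rule card_Un_disjoint) (use fin d in auto)
  finally show ?thesis by (simp add: theta_sign_def power_add)
qed

instantiation superpoly :: ring_1
begin

lift_definition zero_superpoly :: superpoly is "\<lambda>_. 0" by simp

lift_definition one_superpoly :: superpoly is "\<lambda>I. if I = {||} then 1 else 0" by simp

lift_definition plus_superpoly :: "superpoly \<Rightarrow> superpoly \<Rightarrow> superpoly" is "\<lambda>f g I. f I + g I"
proof -
  fix f g :: "nat fset \<Rightarrow> xpoly"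
  assume "finite {I. f I \<noteq> 0}" "finite {I. g I \<noteq> 0}"
  then show "finite {I. f I + g I \<noteq> 0}"
    by (rule finite_subset[rotated, OF finite_UnI]) auto
qed

lift_definition uminus_superpoly :: "superpoly \<Rightarrow> superpoly" is "\<lambda>f I. - f I" by simp

lift_definition minus_superpoly :: "superpoly \<Rightarrow> superpoly \<Rightarrow> superpoly" is "\<lambda>f g I. f I - g I"
proof -
  fix f g :: "nat fset \<Rightarrow> xpoly"
  assume "finite {I. f I \<noteq> 0}" "finite {I. g I \<noteq> 0}"
  then show "finite {I. f I - g I \<noteq> 0}"
    by (rule finite_subset[rotated, OF finite_UnI]) auto
qed

lift_definition times_superpoly :: "superpoly \<Rightarrow> superpoly \<Rightarrow> superpoly"
  is "\<lambda>f g K. \<Sum>I\<in>fset (fPow K). theta_sign I (K |-| I) * f I * g (K |-| I)"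
proof -
  fix f g :: "nat fset \<Rightarrow> xpoly"
  assume fin: "finite {I. f I \<noteq> 0}" "finite {I. g I \<noteq> 0}"
  let ?h = "\<lambda>K. \<Sum>I\<in>fset (fPow K). theta_sign I (K |-| I) * f I * g (K |-| I)"
  have "{K. ?h K \<noteq> 0} \<subseteq> (\<lambda>(I, J). I |\<union>| J) ` ({I. f I \<noteq> 0} \<times> {I. g I \<noteq> 0})"
  proof
    fix K assume "K \<in> {K. ?h K \<noteq> 0}"
    then obtain I where I: "I \<in> fset (fPow K)"
        "theta_sign I (K |-| I) * f I * g (K |-| I) \<noteq> 0"
      by (metis (mono_tags, lifting) mem_Collect_eq sum.neutral)
    then have "I |\<subseteq>| K" by simp
    then have "K = I |\<union>| (K |-| I)" by auto
    moreover have "f I \<noteq> 0" "g (K |-| I) \<noteq> 0" using I(2) by auto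
    ultimately show "K \<in> (\<lambda>(I, J). I |\<union>| J) ` ({I. f I \<noteq> 0} \<times> {I. g I \<noteq> 0})"
      by (intro image_eqI[of _ _ "(I, K |-| I)"]) auto
  qed
  then show "finite {K. ?h K \<noteq> 0}"
    using fin by (meson finite_SigmaI finite_imageI finite_subset)
qed

instance
proof
  fix a b c :: superpoly
  show "a + b + c = a + (b + c)" by transfer (simp add: add.assoc)
  show "a + b = b + a" by transfer (simp add: add.commute)
  show "0 + a = a" by transfer simp
  show "- a + a = 0" by transfer simp
  show "a - b = a + - b" by transfer simp
  show "(a + b) * c = a * c + b * c" by transfer (simp add: algebra_simps sum.distrib)
  show "a * (b + c) = a * b + a * c" by transfer (simp add: algebra_simps sum.distrib)
  show "(0::superpoly) \<noteq> 1" by transfer (auto simp: fun_eq_iff)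
  show "1 * a = a"
  proof transfer
    fix f :: "nat fset \<Rightarrow> xpoly"
    have "(\<Sum>I\<in>fset (fPow K). theta_sign I (K |-| I) * (if I = {||} then 1 else 0) * f (K |-| I))
        = (\<Sum>I\<in>fset (fPow K). if I = {||} then f K else 0)" for K
      by (rule sum.cong) auto
    then show "(\<lambda>K. \<Sum>I\<in>fset (fPow K). theta_sign I (K |-| I) * (if I = {||} then 1 else 0)
        * f (K |-| I)) = f"
      by (simp add: fun_eq_iff)
  qed
  show "a * 1 = a"
  proof transfer
    fix f :: "nat fset \<Rightarrow> xpoly"
    have "(\<Sum>I\<in>fset (fPow K). theta_sign I (K |-| I) * f I * (if K |-| I = {||} then 1 else 0))
        = (\<Sum>I\<in>fset (fPow K). if I = K then f K else 0)" for K
      by (rule sum.cong) auto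
    then show "(\<lambda>K. \<Sum>I\<in>fset (fPow K). theta_sign I (K |-| I) * f I
        * (if K |-| I = {||} then 1 else 0)) = f"
      by (simp add: fun_eq_iff)
  qed
  show "a * b * c = a * (b * c)"
  proof (transfer, rule ext)
    fix f g h :: "nat fset \<Rightarrow> xpoly" and K :: "nat fset"
    have "(\<Sum>L\<in>fset (fPow K). theta_sign L (K |-| L) *
            (\<Sum>I\<in>fset (fPow L). theta_sign I (L |-| I) * f I * g (L |-| I)) * h (K |-| L))
        = (\<Sum>(L, I)\<in>Sigma (fset (fPow K)) (\<lambda>L. fset (fPow L)).
            theta_sign L (K |-| L) * theta_sign I (L |-| I) * f I * g (L |-| I) * h (K |-| L))"
      by (simp add: sum.Sigma[symmetric] sum_distrib_left sum_distrib_right mult_ac)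
    also have "\<dots> = (\<Sum>(I, J)\<in>Sigma (fset (fPow K)) (\<lambda>I. fset (fPow (K |-| I))).
            theta_sign I (K |-| I) * theta_sign J (K |-| I |-| J) * f I * g J * h (K |-| I |-| J))"
    proof (rule sum.reindex_bij_witness[where
          i = "\<lambda>(I, J). (I |\<union>| J, I)" and j = "\<lambda>(L, I). (I, L |-| I)"])
      fix z assume "z \<in> Sigma (fset (fPow K)) (\<lambda>L. fset (fPow L))"
      then obtain L I where z: "z = (L, I)" and L: "L |\<subseteq>| K" and I: "I |\<subseteq>| L" by auto
      define J M where "J = L |-| I" and "M = K |-| L"
      have eq: "L = I |\<union>| J" "K |-| I = J |\<union>| M" "K |-| I |-| J = M"
        using L I by (auto simp: J_def M_def)
      have dis: "I |\<inter>| J = {||}" "J |\<inter>| M = {||}"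
        by (auto simp: J_def M_def)
      have "theta_sign L M * theta_sign I J = theta_sign I (K |-| I) * theta_sign J M"
        unfolding eq(2) unfolding eq(1)
        using theta_sign_union_left[OF dis(1), of M] theta_sign_union_right[OF dis(2), of I]
        by (simp add: mult_ac)
      then show "(case case z of (L, I) \<Rightarrow> (I, L |-| I) of (I, J) \<Rightarrow>
            theta_sign I (K |-| I) * theta_sign J (K |-| I |-| J) * f I * g J * h (K |-| I |-| J))
          = (case z of (L, I) \<Rightarrow>
            theta_sign L (K |-| L) * theta_sign I (L |-| I) * f I * g (L |-| I) * h (K |-| L))"
        unfolding z prod.case J_def[symmetric] eq(3) M_def[symmetric] by simp
    qed auto
    also have "\<dots> = (\<Sum>I\<in>fset (fPow K). theta_sign I (K |-| I) * f I *
        (\<Sum>J\<in>fset (fPow (K |-| I)). theta_sign J (K |-| I |-| J) * g J * h (K |-| I |-| J)))"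
      by (simp add: sum.Sigma[symmetric] sum_distrib_left mult_ac)
    finally show "(\<Sum>L\<in>fset (fPow K). theta_sign L (K |-| L) *
            (\<Sum>I\<in>fset (fPow L). theta_sign I (L |-| I) * f I * g (L |-| I)) * h (K |-| L))
        = (\<Sum>I\<in>fset (fPow K). theta_sign I (K |-| I) * f I *
        (\<Sum>J\<in>fset (fPow (K |-| I)). theta_sign J (K |-| I |-| J) * g J * h (K |-| I |-| J)))" .
  qed
qed

end

lift_definition of_xpoly :: "xpoly \<Rightarrow> superpoly" is "\<lambda>p I. if I = {||} then p else 0" by simp

lift_definition theta :: "nat \<Rightarrow> superpoly" is "\<lambda>i I. if I = {|i|} then 1 else 0" by simp

definition scale :: "complex \<Rightarrow> superpoly \<Rightarrow> superpoly" where
  "scale c f = of_xpoly (cst c) * f"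

text \<open>Operators on polynomials in \<open>x\<close> act on superpolynomials coefficientwise.\<close>

lift_definition coefwise :: "(xpoly \<Rightarrow> xpoly) \<Rightarrow> superpoly \<Rightarrow> superpoly"
  is "\<lambda>T f I. if f I = 0 then 0 else T (f I)"
  by (erule finite_subset[rotated]) auto

lemma coef_of_xpoly_mult: "coef (of_xpoly p * f) K = p * coef f K"
proof transfer
  fix p :: xpoly and f :: "nat fset \<Rightarrow> xpoly" and K
  have "(\<Sum>I\<in>fset (fPow K). theta_sign I (K |-| I) * (if I = {||} then p else 0) * f (K |-| I))
      = (\<Sum>I\<in>fset (fPow K). if I = {||} then p * f K else 0)"
    by (rule sum.cong) auto
  then show "(\<Sum>I\<in>fset (fPow K). theta_sign I (K |-| I) * (if I = {||} then p else 0) * f (K |-| I))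
      = p * f K" by simp
qed

lemma coef_scale: "coef (scale c f) K = cst c * coef f K"
  by (simp add: scale_def coef_of_xpoly_mult)

global_interpretation superpoly: vector_space scale
proof
  fix a b :: complex and f g :: superpoly
  show "scale a (f + g) = scale a f + scale a g"
    by (simp add: scale_def distrib_left)
  show "scale (a + b) f = scale a f + scale b f"
    by (rule coef_inject[THEN iffD1], rule ext)
      (simp add: coef_scale plus_superpoly.rep_eq cst_def single_add distrib_right)
  show "scale a (scale b f) = scale (a * b) f"
    by (rule coef_inject[THEN iffD1], rule ext)
      (simp add: coef_scale cst_def mult.assoc[symmetric] mult_single)
  show "scale 1 f = f"
    by (rule coef_inject[THEN iffD1], rule ext) (simp add: coef_scale cst_def)
qed

lemma theta_mult_theta:
  "coef (theta i * theta j) K =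
     (if i \<noteq> j \<and> K = {|i, j|} then theta_sign {|i|} {|j|} else 0)"
proof transfer
  fix i j :: nat and K :: "nat fset"
  have "(\<Sum>I\<in>fset (fPow K). theta_sign I (K |-| I) * (if I = {|i|} then 1 else 0)
          * (if K |-| I = {|j|} then 1 else 0))
      = (\<Sum>I\<in>fset (fPow K). if I = {|i|} then
          (if K |-| {|i|} = {|j|} then theta_sign {|i|} {|j|} else 0) else 0)"
    by (rule sum.cong) auto
  also have "\<dots> = (if i |\<in>| K \<and> K |-| {|i|} = {|j|} then theta_sign {|i|} {|j|} else 0)"
    by (auto simp: sum.delta)
  also have "i |\<in>| K \<and> K |-| {|i|} = {|j|} \<longleftrightarrow> i \<noteq> j \<and> K = {|i, j|}"
    by auto
  finally show "(\<Sum>I\<in>fset (fPow K). theta_sign I (K |-| I) * (if I = {|i|} then 1 else 0)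
          * (if K |-| I = {|j|} then 1 else 0))
      = (if i \<noteq> j \<and> K = {|i, j|} then theta_sign {|i|} {|j|} else 0)" .
qed

lemma theta_square: "theta i * theta i = 0"
  by (rule coef_inject[THEN iffD1], rule ext) (simp add: theta_mult_theta zero_superpoly.rep_eq)

lemma theta_anticommute: "theta i * theta j = - (theta j * theta i)"
proof -
  have "theta_sign {|i|} {|j|} = - theta_sign {|j|} {|i|}" if "i \<noteq> j"
  proof -
    have "{(a, b) \<in> fset {|i|} \<times> fset {|j|}. b < a} = (if j < i then {(i, j)} else {})"
      for i j :: nat by auto
    then show ?thesis using that by (auto simp: theta_sign_def)
  qed
  moreover have "{|i, j|} = {|j, i|}" by auto
  ultimately show ?thesis
    by (intro coef_inject[THEN iffD1] ext)
      (auto simp: theta_mult_theta uminus_superpoly.rep_eq)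
qed

text \<open>Superpolynomials in \<open>x\<^sub>1, \<dots>, x\<^sub>N\<close> and \<open>\<theta>\<^sub>1, \<dots>, \<theta>\<^sub>N\<close>.\<close>

definition superpolys :: "nat \<Rightarrow> superpoly set" where
  "superpolys N = {f. \<forall>I. coef f I \<noteq> 0 \<longrightarrow>
     fset I \<subseteq> {1..N} \<and> (\<forall>e\<in>Poly_Mapping.keys (coef f I). Poly_Mapping.keys e \<subseteq> {1..N})}"


section \<open>Permutations and symmetric superpolynomials\<close>

definition x_perm :: "(nat \<Rightarrow> nat) \<Rightarrow> superpoly \<Rightarrow> superpoly" where
  "x_perm \<sigma> f = coefwise (x_subst \<sigma>) f"

definition theta_perm :: "(nat \<Rightarrow> nat) \<Rightarrow> superpoly \<Rightarrow> superpoly" where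
  "theta_perm \<sigma> f = (\<Sum>I | coef f I \<noteq> 0.
     of_xpoly (coef f I) * prod_list (map (\<lambda>i. theta (\<sigma> i)) (sorted_list_of_set (fset I))))"

definition super_perm :: "(nat \<Rightarrow> nat) \<Rightarrow> superpoly \<Rightarrow> superpoly" where
  "super_perm \<sigma> f = theta_perm \<sigma> (x_perm \<sigma> f)"

definition sym_superpolys :: "nat \<Rightarrow> superpoly set" where
  "sym_superpolys N = {f \<in> superpolys N.
     \<forall>i\<in>{1..N}. \<forall>j\<in>{1..N}. super_perm (transpose i j) f = f}"


section \<open>Superpartitions, monomials and power sums\<close>

text \<open>
  \<open>(A, B)\<close> stands for \<open>(\<Lambda>\<^sub>1, \<dots>, \<Lambda>\<^sub>m; \<Lambda>\<^sub>m\<^sub>+\<^sub>1, \<dots>, \<Lambda>\<^sub>N)\<close>; the fermion number is \<open>length A\<close>.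
\<close>

type_synonym superpartition = "nat list \<times> nat list"

definition superpartitions :: "nat \<Rightarrow> superpartition set" where
  "superpartitions N = {(A, B). length A + length B = N \<and> sorted_wrt (>) A \<and> sorted_wrt (\<ge>) B}"

definition entries :: "superpartition \<Rightarrow> nat list" where
  "entries \<Lambda> = fst \<Lambda> @ snd \<Lambda>"

definition degree :: "superpartition \<Rightarrow> nat" where
  "degree \<Lambda> = sum_list (entries \<Lambda>)"

definition u_le :: "superpartition \<Rightarrow> superpartition \<Rightarrow> bool" (infix \<open>\<le>\<^sub>u\<close> 50) where
  "\<Omega> \<le>\<^sub>u \<Lambda> \<longleftrightarrow> \<Omega> = \<Lambda> \<or> (\<exists>n::nat. n \<ge> 1 \<and> int (degree \<Omega>) = int (degree \<Lambda>) - 2 * int n)"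

definition u_less :: "superpartition \<Rightarrow> superpartition \<Rightarrow> bool" (infix \<open><\<^sub>u\<close> 50) where
  "\<Omega> <\<^sub>u \<Lambda> \<longleftrightarrow> \<Omega> \<le>\<^sub>u \<Lambda> \<and> \<Omega> \<noteq> \<Lambda>"

definition super_monom :: "superpartition \<Rightarrow> superpoly" where
  "super_monom \<Lambda> = prod_list (map theta [1..<Suc (length (fst \<Lambda>))]) *
     of_xpoly (\<Prod>i=1..length (entries \<Lambda>). X i ^ (entries \<Lambda> ! (i - 1)))"

definition m_norm :: "superpartition \<Rightarrow> nat" where
  "m_norm \<Lambda> = (\<Prod>i\<in>set (snd \<Lambda>). fact (count_list (snd \<Lambda>) i))"

definition m_super :: "nat \<Rightarrow> superpartition \<Rightarrow> superpoly" where
  "m_super N \<Lambda> = scale (1 / of_nat (m_norm \<Lambda>))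
     (\<Sum>\<sigma> | \<sigma> permutes {1..N}. super_perm \<sigma> (super_monom \<Lambda>))"

definition power_sum :: "nat \<Rightarrow> nat \<Rightarrow> superpoly" where
  "power_sum N n = (if n = 0 then 1 else of_xpoly (\<Sum>i=1..N. X i ^ n))"

definition fermionic_power_sum :: "nat \<Rightarrow> nat \<Rightarrow> superpoly" where
  "fermionic_power_sum N n = (\<Sum>i=1..N. theta i * of_xpoly (X i ^ n))"

definition p_super :: "nat \<Rightarrow> superpartition \<Rightarrow> superpoly" where
  "p_super N \<Lambda> = prod_list (map (fermionic_power_sum N) (fst \<Lambda>)) *
     prod_list (map (power_sum N) (snd \<Lambda>))"


section \<open>Operators\<close>

definition Laplacian :: "nat \<Rightarrow> nat \<Rightarrow> superpoly \<Rightarrow> superpoly" where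
  "Laplacian N \<beta> f = (\<Sum>j=1..N. coefwise (dunkl N \<beta> j) (coefwise (dunkl N \<beta> j) f))"

text \<open>
  The exponential of an operator that is locally nilpotent, as \<open>Laplacian N \<beta>\<close> is:
  \<open>Sum_any\<close> adds up the finitely many nonzero terms of the series.
\<close>

definition exp_op :: "complex \<Rightarrow> (superpoly \<Rightarrow> superpoly) \<Rightarrow> superpoly \<Rightarrow> superpoly" where
  "exp_op t T f = Sum_any (\<lambda>n. scale (t ^ n / fact n) ((T ^^ n) f))"

definition exp_Laplacian :: "nat \<Rightarrow> nat \<Rightarrow> real \<Rightarrow> superpoly \<Rightarrow> superpoly" where
  "exp_Laplacian N \<beta> t = exp_op (complex_of_real t) (Laplacian N \<beta>)"

definition H1 :: "nat \<Rightarrow> nat \<Rightarrow> real \<Rightarrow> superpoly \<Rightarrow> superpoly" where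
  "H1 N \<beta> \<omega> f = exp_Laplacian N \<beta> (- 1 / (4 * \<omega>))
     (coefwise (x_euler N) (exp_Laplacian N \<beta> (1 / (4 * \<omega>)) f))"

definition m_omega :: "nat \<Rightarrow> nat \<Rightarrow> real \<Rightarrow> superpartition \<Rightarrow> superpoly" where
  "m_omega N \<beta> \<omega> \<Lambda> = exp_Laplacian N \<beta> (- 1 / (4 * \<omega>)) (m_super N \<Lambda>)"

definition p_omega :: "nat \<Rightarrow> nat \<Rightarrow> real \<Rightarrow> superpartition \<Rightarrow> superpoly" where
  "p_omega N \<beta> \<omega> \<Lambda> = exp_Laplacian N \<beta> (- 1 / (4 * \<omega>)) (p_super N \<Lambda>)"


section \<open>Bases indexed by superpartitions\<close>

definition is_basis :: "nat \<Rightarrow> (superpartition \<Rightarrow> superpoly) \<Rightarrow> bool" where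
  "is_basis N b \<longleftrightarrow> inj_on b (superpartitions N) \<and>
     superpoly.independent (b ` superpartitions N) \<and>
     superpoly.span (b ` superpartitions N) = sym_superpolys N"

definition u_triangular ::
    "nat \<Rightarrow> (superpartition \<Rightarrow> superpoly) \<Rightarrow> (superpartition \<Rightarrow> superpoly) \<Rightarrow> bool" where
  "u_triangular N e b \<longleftrightarrow> (\<exists>y :: superpartition \<Rightarrow> superpartition \<Rightarrow> complex.
     \<forall>\<Lambda>\<in>superpartitions N.
       b \<Lambda> = e \<Lambda> + (\<Sum>\<Omega> | \<Omega> \<in> superpartitions N \<and> \<Omega> <\<^sub>u \<Lambda>. scale (y \<Lambda> \<Omega>) (e \<Omega>)))"

definition H1_eigen :: "nat \<Rightarrow> nat \<Rightarrow> real \<Rightarrow> (superpartition \<Rightarrow> superpoly) \<Rightarrow> bool" where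
  "H1_eigen N \<beta> \<omega> b \<longleftrightarrow>
     (\<forall>\<Lambda>\<in>superpartitions N. H1 N \<beta> \<omega> (b \<Lambda>) = scale (of_nat (degree \<Lambda>)) (b \<Lambda>))"

end

theory Submission
  imports Defs
begin

text \<open>
  Write \<open>E = e^(- \<Delta> / 4\<omega>)\<close>; it is invertible on the symmetric superpolynomials, and
  \<open>H1 = E \<circ> Euler \<circ> E\<inverse>\<close>. Hence \<open>E\<close> carries a homogeneous basis to a basis of eigenvectors, and since
  \<open>\<Delta>\<close> lowers the degree by 2 the result is \<open>u\<close>-triangular. Conversely, \<open>E\<inverse>\<close> of a \<open>u\<close>-triangular
  eigenvector is homogeneous, so it is the top degree component.

  That \<open>m\<^sub>\<Lambda>\<close> and \<open>p\<^sub>\<Lambda>\<close> are bases follows from the coefficients \<open>lead \<Omega>\<close> of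
  \<open>\<theta>\<^sub>1 \<dots> \<theta>\<^sub>m x\<^sup>\<Omega>\<close>, which determine a symmetric superpolynomial. In the expansion of \<open>p\<^sub>\<Lambda>\<close> a term in
  which no positive bosonic part shares its index with another part can only contribute to
  \<open>lead \<Lambda>\<close>, with sign \<open>+1\<close>; in every other term parts merge, which leaves fewer positive bosonic
  parts. So the matrix of \<open>lead \<Omega> p\<^sub>\<Lambda>\<close> is triangular for the number of these parts.
\<close>

section \<open>Polynomials\<close>

lemma xpoly_induct [case_names zero single add]:
  fixes p :: xpoly
  assumes "P 0" "\<And>e c. P (Poly_Mapping.single e c)" "\<And>p q. P p \<Longrightarrow> P q \<Longrightarrow> P (p + q)"
  shows "P p"
proof -
  have "P (\<Sum>e\<in>S. Poly_Mapping.single e (Poly_Mapping.lookup p e))" for S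
    by (induction S rule: infinite_finite_induct) (auto intro: assms)
  then show ?thesis by (metis sum_single)
qed

definition total :: "(nat \<Rightarrow>\<^sub>0 nat) \<Rightarrow> nat" where
  "total e = (\<Sum>i\<in>Poly_Mapping.keys e. Poly_Mapping.lookup e i)"

lemma total_zero [simp]: "total 0 = 0"
  by (simp add: total_def)

lemma total_single [simp]: "total (Poly_Mapping.single i n) = n"
  by (simp add: total_def)

lemma total_add [simp]: "total (e + e') = total e + total e'"
  unfolding total_def by (rule setsum_keys_plus_distrib) auto

lemma total_sum: "total (\<Sum>i\<in>A. e i) = (\<Sum>i\<in>A. total (e i))"
  by (induction A rule: infinite_finite_induct) auto

definition relabel :: "(nat \<Rightarrow> nat) \<Rightarrow> (nat \<Rightarrow>\<^sub>0 nat) \<Rightarrow> (nat \<Rightarrow>\<^sub>0 nat)" where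
  "relabel \<sigma> e = (\<Sum>i\<in>Poly_Mapping.keys e. Poly_Mapping.single (\<sigma> i) (Poly_Mapping.lookup e i))"

lemma relabel_zero [simp]: "relabel \<sigma> 0 = 0"
  by (simp add: relabel_def)

lemma relabel_single [simp]:
  "relabel \<sigma> (Poly_Mapping.single i n) = Poly_Mapping.single (\<sigma> i) n"
  by (simp add: relabel_def)

lemma relabel_add: "relabel \<sigma> (e + e') = relabel \<sigma> e + relabel \<sigma> e'"
  unfolding relabel_def by (rule setsum_keys_plus_distrib) (auto simp: single_add)

lemma relabel_sum: "relabel \<sigma> (\<Sum>i\<in>A. e i) = (\<Sum>i\<in>A. relabel \<sigma> (e i))"
  by (induction A rule: infinite_finite_induct) (auto simp: relabel_add)

lemma exponent_sum:
  "(\<Sum>i\<in>Poly_Mapping.keys e. Poly_Mapping.single i (Poly_Mapping.lookup e i)) = e"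
  by (rule poly_mapping_eqI) (simp add: lookup_sum lookup_single when_def in_keys_iff)

lemma relabel_relabel: "relabel \<tau> (relabel \<sigma> e) = relabel (\<tau> \<circ> \<sigma>) e"
  by (simp add: relabel_def[of \<sigma>] relabel_sum) (simp add: relabel_def)

lemma lookup_relabel:
  assumes "inj \<sigma>"
  shows "Poly_Mapping.lookup (relabel \<sigma> e) (\<sigma> i) = Poly_Mapping.lookup e i"
proof -
  have "Poly_Mapping.lookup (relabel \<sigma> e) (\<sigma> i)
      = (\<Sum>j\<in>Poly_Mapping.keys e. if j = i then Poly_Mapping.lookup e i else 0)"
    unfolding relabel_def lookup_sum
    by (rule sum.cong) (use assms in \<open>auto simp: lookup_single when_def inj_def\<close>)
  then show ?thesis by (simp add: in_keys_iff)
qed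

lemma inj_relabel: "inj \<sigma> \<Longrightarrow> inj (relabel \<sigma>)"
  by (rule injI, rule poly_mapping_eqI) (metis lookup_relabel)

lemma total_relabel: "total (relabel \<sigma> e) = total e"
  by (simp add: relabel_def total_sum) (simp add: total_def)

lemma keys_relabel: "Poly_Mapping.keys (relabel \<sigma> e) \<subseteq> \<sigma> ` Poly_Mapping.keys e"
proof
  fix j assume "j \<in> Poly_Mapping.keys (relabel \<sigma> e)"
  then have "(\<Sum>i\<in>Poly_Mapping.keys e. Poly_Mapping.lookup (Poly_Mapping.single (\<sigma> i) (Poly_Mapping.lookup e i)) j) \<noteq> 0"
    by (simp add: relabel_def in_keys_iff lookup_sum)
  then obtain i where "i \<in> Poly_Mapping.keys e"
      "Poly_Mapping.lookup (Poly_Mapping.single (\<sigma> i) (Poly_Mapping.lookup e i)) j \<noteq> 0"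
    by (meson sum.neutral)
  then show "j \<in> \<sigma> ` Poly_Mapping.keys e"
    by (auto simp: lookup_single when_def split: if_splits)
qed

lemma x_subst_single:
  "x_subst \<sigma> (Poly_Mapping.single e c) = Poly_Mapping.single (relabel \<sigma> e) c"
  by (simp add: x_subst_def X_power prod_single_one relabel_def cst_def mult_single)

lemma x_subst_zero [simp]: "x_subst \<sigma> 0 = 0"
  by (simp add: x_subst_def)

lemma x_subst_add: "x_subst \<sigma> (p + q) = x_subst \<sigma> p + x_subst \<sigma> q"
  unfolding x_subst_def
  by (rule setsum_keys_plus_distrib) (auto simp: cst_def single_add distrib_right)

lemma x_subst_mult: "x_subst \<sigma> (p * q) = x_subst \<sigma> p * x_subst \<sigma> q"
proof (induction p rule: xpoly_induct)
  case (single e c)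
  show ?case
    by (induction q rule: xpoly_induct)
      (simp_all add: x_subst_single mult_single relabel_add x_subst_add distrib_left)
qed (simp_all add: x_subst_add distrib_right)

lemma x_subst_uminus: "x_subst \<sigma> (- p) = - x_subst \<sigma> p"
  using x_subst_add[of \<sigma> p "- p"] by (simp add: eq_neg_iff_add_eq_0 add.commute)

lemma x_subst_diff: "x_subst \<sigma> (p - q) = x_subst \<sigma> p - x_subst \<sigma> q"
  by (simp only: diff_conv_add_uminus x_subst_add x_subst_uminus)

lemma x_subst_one [simp]: "x_subst \<sigma> 1 = 1"
  using x_subst_single[of \<sigma> 0 1] by simp

lemma x_subst_cst [simp]: "x_subst \<sigma> (cst c) = cst c"
  by (simp add: cst_def x_subst_single)

lemma x_subst_X [simp]: "x_subst \<sigma> (X i) = X (\<sigma> i)"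
  by (simp add: X_def x_subst_single)

lemma x_subst_sum: "x_subst \<sigma> (\<Sum>i\<in>A. p i) = (\<Sum>i\<in>A. x_subst \<sigma> (p i))"
  by (induction A rule: infinite_finite_induct) (auto simp: x_subst_add)

lemma x_subst_x_subst: "x_subst \<tau> (x_subst \<sigma> p) = x_subst (\<tau> \<circ> \<sigma>) p"
  by (induction p rule: xpoly_induct) (auto simp: x_subst_single x_subst_add relabel_relabel comp_def)

lemma lookup_x_subst:
  assumes "inj \<sigma>"
  shows "Poly_Mapping.lookup (x_subst \<sigma> p) (relabel \<sigma> e) = Poly_Mapping.lookup p e"
  using inj_relabel[OF assms]
  by (induction p rule: xpoly_induct)
    (auto simp: x_subst_single x_subst_add lookup_add lookup_single when_def inj_eq)

lemma x_subst_of_nat [simp]: "x_subst \<sigma> (of_nat n) = of_nat n"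
  by (induction n) (auto simp: x_subst_add)

lemma exponent_minus_add:
  "0 < Poly_Mapping.lookup e j \<Longrightarrow> e = (e - Poly_Mapping.single j 1) + Poly_Mapping.single j (1::nat)"
  by (rule poly_mapping_eqI) (auto simp: lookup_add lookup_minus lookup_single when_def)

lemma x_deriv_single:
  "x_deriv j (Poly_Mapping.single e c) =
     Poly_Mapping.single (e - Poly_Mapping.single j 1) (of_nat (Poly_Mapping.lookup e j) * c)"
  by (simp add: x_deriv_def)

lemma x_deriv_zero [simp]: "x_deriv j 0 = 0"
  by (simp add: x_deriv_def)

lemma x_deriv_add: "x_deriv j (p + q) = x_deriv j p + x_deriv j q"
  unfolding x_deriv_def
  by (rule setsum_keys_plus_distrib) (auto simp: single_add distrib_left)

lemma cst_mult_single: "cst a * Poly_Mapping.single e c = Poly_Mapping.single e (a * c)"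
  by (simp add: cst_def mult_single)

lemma x_deriv_scale: "x_deriv j (cst a * p) = cst a * x_deriv j p"
  by (induction p rule: xpoly_induct)
    (simp_all add: cst_mult_single x_deriv_single x_deriv_add distrib_left mult_ac)

lemma x_subst_x_deriv:
  assumes "inj \<sigma>"
  shows "x_subst \<sigma> (x_deriv j p) = x_deriv (\<sigma> j) (x_subst \<sigma> p)"
proof (induction p rule: xpoly_induct)
  case (single e c)
  show ?case
  proof (cases "Poly_Mapping.lookup e j = 0")
    case True
    then show ?thesis by (simp add: x_deriv_single x_subst_single lookup_relabel[OF assms])
  next
    case False
    define e' where "e' = e - Poly_Mapping.single j 1"
    have e: "e = e' + Poly_Mapping.single j 1"
      using False exponent_minus_add[of e j] by (simp add: e'_def)
    have "relabel \<sigma> e - Poly_Mapping.single (\<sigma> j) 1 = relabel \<sigma> e'"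
      unfolding e by (simp add: relabel_add)
    then show ?thesis
      by (simp add: x_deriv_single x_subst_single lookup_relabel[OF assms] e'_def)
  qed
qed (simp_all add: x_deriv_add x_subst_add)

lemma swap_quot_eq:
  assumes "j \<noteq> k"
  shows "(X j - X k) * swap_quot j k p = p - x_subst (transpose j k) p"
  unfolding swap_quot_def by (rule theI'[OF swap_quot_ex1[OF assms]])

lemma swap_quotI:
  assumes "j \<noteq> k" "(X j - X k) * q = p - x_subst (transpose j k) p"
  shows "swap_quot j k p = q"
proof -
  have "(X j - X k) * swap_quot j k p = (X j - X k) * q"
    using swap_quot_eq[OF assms(1), of p] assms(2) by simp
  then show ?thesis using X_diff_neq_0[OF assms(1)] by (simp only: mult_cancel_left simp_thms)
qed

lemma swap_quot_add:
  assumes "j \<noteq> k"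
  shows "swap_quot j k (p + q) = swap_quot j k p + swap_quot j k q"
  by (rule swap_quotI[OF assms]) (simp add: distrib_left swap_quot_eq[OF assms] x_subst_add)

lemma swap_quot_scale:
  assumes "j \<noteq> k"
  shows "swap_quot j k (cst a * p) = cst a * swap_quot j k p"
proof (rule swap_quotI[OF assms])
  have "(X j - X k) * (cst a * swap_quot j k p) = cst a * ((X j - X k) * swap_quot j k p)"
    by (simp only: mult_ac)
  then show "(X j - X k) * (cst a * swap_quot j k p)
      = cst a * p - x_subst (transpose j k) (cst a * p)"
    by (simp add: swap_quot_eq[OF assms] x_subst_mult right_diff_distrib)
qed

lemma x_subst_swap_quot:
  assumes "inj \<sigma>" "j \<noteq> k"
  shows "x_subst \<sigma> (swap_quot j k p) = swap_quot (\<sigma> j) (\<sigma> k) (x_subst \<sigma> p)"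
proof (rule sym, rule swap_quotI)
  show "\<sigma> j \<noteq> \<sigma> k" using assms by (simp add: inj_eq)
  have "\<sigma> \<circ> transpose j k = transpose (\<sigma> j) (\<sigma> k) \<circ> \<sigma>"
    using assms(1) by (auto simp: fun_eq_iff transpose_def inj_eq)
  then show "(X (\<sigma> j) - X (\<sigma> k)) * x_subst \<sigma> (swap_quot j k p)
      = x_subst \<sigma> p - x_subst (transpose (\<sigma> j) (\<sigma> k)) (x_subst \<sigma> p)"
    using arg_cong[OF swap_quot_eq[OF assms(2), of p], of "x_subst \<sigma>"]
    by (simp add: x_subst_mult x_subst_diff x_subst_x_subst)
qed

definition x_graded :: "nat set \<Rightarrow> nat set \<Rightarrow> xpoly set" where
  "x_graded V D = {p. \<forall>e\<in>Poly_Mapping.keys p. Poly_Mapping.keys e \<subseteq> V \<and> total e \<in> D}"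

lemma x_graded_zero [simp]: "0 \<in> x_graded V D"
  by (simp add: x_graded_def)

lemma x_graded_single:
  "Poly_Mapping.keys e \<subseteq> V \<Longrightarrow> total e \<in> D \<Longrightarrow> Poly_Mapping.single e c \<in> x_graded V D"
  by (simp add: x_graded_def)

lemma x_graded_add: "p \<in> x_graded V D \<Longrightarrow> q \<in> x_graded V D \<Longrightarrow> p + q \<in> x_graded V D"
  using keys_add[of p q] unfolding x_graded_def by blast

lemma x_graded_uminus: "p \<in> x_graded V D \<Longrightarrow> - p \<in> x_graded V D"
  by (simp add: x_graded_def in_keys_iff)

lemma x_graded_sum: "(\<And>i. i \<in> A \<Longrightarrow> p i \<in> x_graded V D) \<Longrightarrow> (\<Sum>i\<in>A. p i) \<in> x_graded V D"
  by (induction A rule: infinite_finite_induct) (auto intro: x_graded_add)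

lemma x_graded_mono: "p \<in> x_graded V D \<Longrightarrow> V \<subseteq> V' \<Longrightarrow> D \<subseteq> D' \<Longrightarrow> p \<in> x_graded V' D'"
  by (auto simp: x_graded_def)

lemma x_graded_mult:
  assumes "p \<in> x_graded V {a}" "q \<in> x_graded V {b}"
  shows "p * q \<in> x_graded V {a + b}"
  unfolding x_graded_def
proof (intro CollectI ballI)
  fix e assume "e \<in> Poly_Mapping.keys (p * q)"
  then obtain e1 e2 where e: "e = e1 + e2" "e1 \<in> Poly_Mapping.keys p" "e2 \<in> Poly_Mapping.keys q"
    using keys_mult[of p q] by blast
  then show "Poly_Mapping.keys e \<subseteq> V \<and> total e \<in> {a + b}"
    using assms keys_add[of e1 e2] by (fastforce simp: x_graded_def)
qed

lemma x_graded_X_power: "i \<in> V \<Longrightarrow> X i ^ n \<in> x_graded V {n}"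
  unfolding X_power by (rule x_graded_single) auto

lemma x_graded_induct [consumes 1, case_names zero single add]:
  assumes "p \<in> x_graded V D" "P 0"
    and "\<And>e c. Poly_Mapping.keys e \<subseteq> V \<Longrightarrow> total e \<in> D \<Longrightarrow> P (Poly_Mapping.single e c)"
    and "\<And>p q. P p \<Longrightarrow> P q \<Longrightarrow> P (p + q)"
  shows "P p"
proof -
  have "S \<subseteq> Poly_Mapping.keys p \<Longrightarrow> P (\<Sum>e\<in>S. Poly_Mapping.single e (Poly_Mapping.lookup p e))" for S
  proof (induction S rule: infinite_finite_induct)
    case (insert e S)
    have "Poly_Mapping.keys e \<subseteq> V" "total e \<in> D"
      using insert.prems assms(1) by (auto simp: x_graded_def)
    then show ?case
      using insert assms(3,4) by simp
  qed (auto intro: assms)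
  then show ?thesis by (metis sum_single order_refl)
qed

lemma x_graded_x_deriv:
  assumes "p \<in> x_graded V D"
  shows "x_deriv j p \<in> x_graded V {d. Suc d \<in> D}"
  using assms
proof (induction rule: x_graded_induct)
  case (single e c)
  show ?case
  proof (cases "Poly_Mapping.lookup e j = 0")
    case False
    define e' where "e' = e - Poly_Mapping.single j 1"
    have e: "e = e' + Poly_Mapping.single j 1"
      using False exponent_minus_add[of e j] by (simp add: e'_def)
    have "Poly_Mapping.keys e' \<subseteq> Poly_Mapping.keys e"
      by (auto simp: e in_keys_iff lookup_add)
    moreover have "total e = Suc (total e')"
      by (simp add: e)
    ultimately show ?thesis
      unfolding x_deriv_single e'_def[symmetric] using single by (intro x_graded_single) auto
  qed (simp add: x_deriv_single)
qed (auto simp: x_deriv_add intro: x_graded_add)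

lemma swap_quot_monom:
  fixes M :: xpoly
  assumes "j \<noteq> k" "x_subst (transpose j k) M = M"
  shows "swap_quot j k (M * X j ^ (b + n) * X k ^ b)
      = M * (X j * X k) ^ b * (\<Sum>i<n. X k ^ (n - Suc i) * X j ^ i)" (is ?th1)
    and "swap_quot j k (M * X j ^ b * X k ^ (b + n))
      = - (M * (X j * X k) ^ b * (\<Sum>i<n. X k ^ (n - Suc i) * X j ^ i))" (is ?th2)
proof -
  have pw: "x_subst \<sigma> (X i ^ r) = X (\<sigma> i) ^ r" for \<sigma> i r
    by (induction r) (simp_all add: x_subst_mult)
  let ?S = "\<Sum>i<n. X k ^ (n - Suc i) * X j ^ i"
  have *: "(X j - X k) * (M * (X j * X k) ^ b * ?S) = M * (X j * X k) ^ b * (X j ^ n - X k ^ n)"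
    using power_diff_sumr2[of "X j" n "X k"] by (simp add: mult_ac)
  show ?th1
    by (rule swap_quotI[OF assms(1)], subst *)
      (simp add: x_subst_mult pw assms(2) power_add power_mult_distrib algebra_simps)
  show ?th2
    by (rule swap_quotI[OF assms(1)], subst mult_minus_right, subst *)
      (simp add: x_subst_mult pw assms(2) power_add power_mult_distrib algebra_simps)
qed

lemma x_graded_swap_quot:
  assumes "p \<in> x_graded V D" "j \<noteq> k" "j \<in> V" "k \<in> V"
  shows "swap_quot j k p \<in> x_graded V {d. Suc d \<in> D}"
  using assms(1)
proof (induction rule: x_graded_induct)
  case zero
  have "swap_quot j k 0 = 0" by (rule swap_quotI[OF assms(2)]) simp
  then show ?case by simp
next
  case (single e c)
  define a b where "a = Poly_Mapping.lookup e j" and "b = Poly_Mapping.lookup e k"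
  define e' where "e' = e - Poly_Mapping.single j a - Poly_Mapping.single k b"
  define M where "M = Poly_Mapping.single e' c"
  have e: "e = e' + Poly_Mapping.single j a + Poly_Mapping.single k b"
    unfolding e'_def a_def b_def using assms(2)
    by (intro poly_mapping_eqI) (auto simp: lookup_add lookup_minus lookup_single when_def)
  have p: "Poly_Mapping.single e c = M * X j ^ a * X k ^ b"
    by (simp add: M_def X_power mult_single e)
  have e'0: "Poly_Mapping.lookup e' j = 0" "Poly_Mapping.lookup e' k = 0"
    unfolding e'_def a_def b_def by (simp_all add: lookup_minus lookup_single)
  have "relabel (transpose j k) e' = relabel id e'"
    unfolding relabel_def
  proof (rule sum.cong[OF refl])
    fix i assume "i \<in> Poly_Mapping.keys e'"
    then have "i \<noteq> j" "i \<noteq> k" using e'0 by (auto simp: in_keys_iff)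
    then show "Poly_Mapping.single (transpose j k i) (Poly_Mapping.lookup e' i)
        = Poly_Mapping.single (id i) (Poly_Mapping.lookup e' i)" by simp
  qed
  also have "\<dots> = e'" by (simp add: relabel_def exponent_sum)
  finally have M: "x_subst (transpose j k) M = M" by (simp add: M_def x_subst_single)
  have "Poly_Mapping.keys e' \<subseteq> Poly_Mapping.keys e"
    by (auto simp: e'_def in_keys_iff lookup_minus)
  then have MV: "M \<in> x_graded V {total e'}"
    using single(1) unfolding M_def by (intro x_graded_single) auto
  have te: "total e = total e' + a + b" by (simp add: e)
  have gr: "M * (X j * X k) ^ s * (\<Sum>i<n. X k ^ (n - Suc i) * X j ^ i) \<in> x_graded V {d. Suc d \<in> D}"
    if "total e = total e' + s + s + n" for s n
  proof (cases n)
    case (Suc n')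
    have "X k ^ (n - Suc i) * X j ^ i \<in> x_graded V {n'}" if "i < n" for i
      using x_graded_mult[OF x_graded_X_power[OF assms(4)] x_graded_X_power[OF assms(3)], of "n - Suc i" i]
        that Suc by simp
    then have "(\<Sum>i<n. X k ^ (n - Suc i) * X j ^ i) \<in> x_graded V {n'}"
      by (intro x_graded_sum) auto
    then have "M * (X j ^ s * X k ^ s) * (\<Sum>i<n. X k ^ (n - Suc i) * X j ^ i)
        \<in> x_graded V {total e' + (s + s) + n'}"
      by (intro x_graded_mult MV x_graded_X_power assms)
    then show ?thesis
      unfolding power_mult_distrib
      by (rule x_graded_mono) (use single(2) that Suc in \<open>auto simp: add.assoc\<close>)
  qed simp
  show ?case
  proof (cases "b \<le> a")
    case True
    then obtain n where n: "a = b + n" using le_Suc_ex by blast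
    show ?thesis
      unfolding p n swap_quot_monom(1)[OF assms(2) M] using te n by (intro gr) simp
  next
    case False
    then obtain n where n: "b = a + n" using le_Suc_ex nat_le_linear by blast
    show ?thesis
      unfolding p n swap_quot_monom(2)[OF assms(2) M]
      using te n by (intro x_graded_uminus gr) simp
  qed
qed (auto simp: swap_quot_add[OF assms(2)] intro: x_graded_add)

lemma dunkl_add: "dunkl N \<beta> j (p + q) = dunkl N \<beta> j p + dunkl N \<beta> j q"
proof -
  have "(\<Sum>k\<in>{1..N} - {j}. swap_quot j k (p + q))
      = (\<Sum>k\<in>{1..N} - {j}. swap_quot j k p) + (\<Sum>k\<in>{1..N} - {j}. swap_quot j k q)"
    unfolding sum.distrib[symmetric] by (rule sum.cong) (auto intro: swap_quot_add)
  then show ?thesis by (simp add: dunkl_def x_deriv_add distrib_left)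
qed

lemma dunkl_scale: "dunkl N \<beta> j (cst a * p) = cst a * dunkl N \<beta> j p"
proof -
  have *: "(\<Sum>k\<in>{1..N} - {j}. swap_quot j k (cst a * p)) = cst a * (\<Sum>k\<in>{1..N} - {j}. swap_quot j k p)"
    unfolding sum_distrib_left by (rule sum.cong) (auto intro: swap_quot_scale)
  show ?thesis unfolding dunkl_def x_deriv_scale * distrib_left by (simp only: mult.left_commute)
qed

lemma x_subst_dunkl:
  assumes "\<sigma> permutes {1..N}"
  shows "x_subst \<sigma> (dunkl N \<beta> j p) = dunkl N \<beta> (\<sigma> j) (x_subst \<sigma> p)"
proof -
  have inj: "inj \<sigma>" using assms by (rule permutes_inj)
  have img: "\<sigma> ` ({1..N} - {j}) = {1..N} - {\<sigma> j}"
    using image_set_diff[OF inj, of "{1..N}" "{j}"] permutes_image[OF assms] by simp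
  have "x_subst \<sigma> (\<Sum>k\<in>{1..N} - {j}. swap_quot j k p)
      = (\<Sum>k\<in>{1..N} - {j}. swap_quot (\<sigma> j) (\<sigma> k) (x_subst \<sigma> p))"
    unfolding x_subst_sum by (rule sum.cong) (auto intro: x_subst_swap_quot[OF inj])
  also have "\<dots> = (\<Sum>k\<in>{1..N} - {\<sigma> j}. swap_quot (\<sigma> j) k (x_subst \<sigma> p))"
    unfolding img[symmetric] by (subst sum.reindex) (auto intro: inj_on_subset[OF inj])
  finally show ?thesis
    by (simp add: dunkl_def x_subst_add x_subst_mult x_subst_x_deriv[OF inj])
qed

lemma x_graded_dunkl:
  assumes "p \<in> x_graded V D" "j \<in> V" "{1..N} \<subseteq> V"
  shows "dunkl N \<beta> j p \<in> x_graded V {d. Suc d \<in> D}"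
proof -
  have "q \<in> x_graded V E \<Longrightarrow> of_nat n * q \<in> x_graded V E" for q E and n :: nat
    by (induction n) (auto simp: distrib_right intro: x_graded_add)
  moreover have "(\<Sum>k\<in>{1..N} - {j}. swap_quot j k p) \<in> x_graded V {d. Suc d \<in> D}"
    by (intro x_graded_sum x_graded_swap_quot) (use assms in auto)
  ultimately show ?thesis
    unfolding dunkl_def by (intro x_graded_add x_graded_x_deriv assms) auto
qed

lemma lookup_x_euler:
  assumes "p \<in> x_graded {1..N} UNIV"
  shows "Poly_Mapping.lookup (x_euler N p) e = of_nat (total e) * Poly_Mapping.lookup p e"
  using assms
proof (induction rule: x_graded_induct)
  case (single e' c)
  have "X j * x_deriv j (Poly_Mapping.single e' c)
      = Poly_Mapping.single e' (of_nat (Poly_Mapping.lookup e' j) * c)" for j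
  proof (cases "Poly_Mapping.lookup e' j = 0")
    case False
    then show ?thesis
      using exponent_minus_add[of e' j]
      by (simp add: x_deriv_single X_def mult_single add.commute)
  qed (simp add: x_deriv_single)
  moreover have "(\<Sum>j\<in>A. Poly_Mapping.single e' (f j)) = Poly_Mapping.single e' (\<Sum>j\<in>A. f j)"
    for A and f :: "nat \<Rightarrow> complex"
    by (induction A rule: infinite_finite_induct) (simp_all add: single_add)
  ultimately have "x_euler N (Poly_Mapping.single e' c)
      = Poly_Mapping.single e' ((\<Sum>j=1..N. of_nat (Poly_Mapping.lookup e' j)) * c)"
    by (simp only: x_euler_def sum_distrib_right)
  also have "(\<Sum>j=1..N. of_nat (Poly_Mapping.lookup e' j)) = (of_nat (total e') :: complex)"
    unfolding total_def of_nat_sum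
    by (rule sum.mono_neutral_right) (use single(1) in \<open>auto simp: in_keys_iff\<close>)
  finally show ?case by (simp add: lookup_single when_def)
qed (auto simp: x_euler_def x_deriv_add distrib_left lookup_add lookup_sum sum.distrib)

section \<open>Products of anticommuting variables\<close>

lemma superpoly_eqI: "(\<And>I. coef f I = coef g I) \<Longrightarrow> f = g"
  by (rule coef_inject[THEN iffD1], rule ext)

lemma finite_coef: "finite {I. coef f I \<noteq> 0}"
  using coef[of f] by simp

lemma coef_zero [simp]: "coef 0 I = 0"
  by (simp add: zero_superpoly.rep_eq)

lemma coef_add [simp]: "coef (f + g) I = coef f I + coef g I"
  by (simp add: plus_superpoly.rep_eq)

lemma coef_diff [simp]: "coef (f - g) I = coef f I - coef g I"
  by (simp add: minus_superpoly.rep_eq)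

lemma coef_uminus [simp]: "coef (- f) I = - coef f I"
  by (simp add: uminus_superpoly.rep_eq)

lemma coef_sum: "coef (\<Sum>i\<in>A. f i) I = (\<Sum>i\<in>A. coef (f i) I)"
  by (induction A rule: infinite_finite_induct) auto

lemma coef_one: "coef 1 I = (if I = {||} then 1 else 0)"
  by (simp add: one_superpoly.rep_eq)

lemma coef_of_xpoly: "coef (of_xpoly p) I = (if I = {||} then p else 0)"
  by (simp add: of_xpoly.rep_eq)

lemma coef_mult_of_xpoly: "coef (f * of_xpoly p) K = coef f K * p"
proof transfer
  fix p :: xpoly and f :: "nat fset \<Rightarrow> xpoly" and K
  have "(\<Sum>I\<in>fset (fPow K). theta_sign I (K |-| I) * f I * (if K |-| I = {||} then p else 0))
      = (\<Sum>I\<in>fset (fPow K). if I = K then f K * p else 0)"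
    by (rule sum.cong) auto
  then show "(\<Sum>I\<in>fset (fPow K). theta_sign I (K |-| I) * f I * (if K |-| I = {||} then p else 0))
      = f K * p" by simp
qed

lemma of_xpoly_commute: "f * of_xpoly p = of_xpoly p * f"
  by (rule superpoly_eqI) (simp add: coef_mult_of_xpoly coef_of_xpoly_mult mult.commute)

lemma of_xpoly_zero [simp]: "of_xpoly 0 = 0"
  and of_xpoly_one [simp]: "of_xpoly 1 = 1"
  and of_xpoly_add: "of_xpoly (p + q) = of_xpoly p + of_xpoly q"
  and of_xpoly_mult: "of_xpoly (p * q) = of_xpoly p * of_xpoly q"
  by (rule superpoly_eqI, simp add: coef_of_xpoly coef_of_xpoly_mult coef_one)+

lemma of_xpoly_sum: "of_xpoly (\<Sum>i\<in>A. p i) = (\<Sum>i\<in>A. of_xpoly (p i))"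
  by (induction A rule: infinite_finite_induct) (auto simp: of_xpoly_add)

lemma coef_theta_mult:
  "coef (theta i * f) K =
     (if i |\<in>| K then theta_sign {|i|} (K |-| {|i|}) * coef f (K |-| {|i|}) else 0)"
proof transfer
  fix i and f :: "nat fset \<Rightarrow> xpoly" and K
  have "(\<Sum>I\<in>fset (fPow K). theta_sign I (K |-| I) * (if I = {|i|} then 1 else 0) * f (K |-| I))
      = (\<Sum>I\<in>fset (fPow K). if I = {|i|} then theta_sign {|i|} (K |-| {|i|}) * f (K |-| {|i|}) else 0)"
    by (rule sum.cong) auto
  then show "(\<Sum>I\<in>fset (fPow K). theta_sign I (K |-| I) * (if I = {|i|} then 1 else 0) * f (K |-| I))
      = (if i |\<in>| K then theta_sign {|i|} (K |-| {|i|}) * f (K |-| {|i|}) else 0)"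
    by simp
qed

definition Theta :: "nat list \<Rightarrow> superpoly" where
  "Theta xs = prod_list (map theta xs)"

lemma Theta_Nil [simp]: "Theta [] = 1"
  and Theta_Cons: "Theta (x # xs) = theta x * Theta xs"
  and Theta_append: "Theta (xs @ ys) = Theta xs * Theta ys"
  by (simp_all add: Theta_def)

lemma coef_Theta_sorted:
  "sorted_wrt (<) xs \<Longrightarrow> coef (Theta xs) K = (if K = fset_of_list xs then 1 else 0)"
proof (induction xs arbitrary: K)
  case (Cons x xs)
  have x: "x |\<notin>| fset_of_list xs"
    using Cons.prems by (auto simp: fset_of_list_elem)
  have "{(i, j) \<in> fset {|x|} \<times> fset (fset_of_list xs). j < i} = {}"
    using Cons.prems by (auto simp: fset_of_list.rep_eq)
  then have sgn: "theta_sign {|x|} (fset_of_list xs) = 1"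
    unfolding theta_sign_def by (metis card.empty power_0)
  have "x |\<in>| K \<and> K |-| {|x|} = fset_of_list xs \<longleftrightarrow> K = finsert x (fset_of_list xs)"
    using x by auto
  then show ?case
    using Cons sgn by (auto simp: Theta_Cons coef_theta_mult)
qed (simp add: coef_one)

lemma Theta_swap: "Theta (us @ [a, b] @ vs) = - Theta (us @ [b, a] @ vs)"
proof -
  have "theta a * (theta b * Theta vs) = - (theta b * (theta a * Theta vs))"
    using theta_anticommute[of a b] by (simp flip: mult.assoc)
  then show ?thesis by (simp add: Theta_append Theta_Cons)
qed

lemma Theta_insort:
  "\<exists>s\<in>{1, - 1}. \<forall>g. Theta (map g (x # ys)) = s * Theta (map g (insort x ys))"
proof (induction ys)
  case (Cons y ys)
  show ?case
  proof (cases "x \<le> y")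
    case False
    obtain s where s: "s \<in> {1, - 1}"
        "\<And>g. Theta (map g (x # ys)) = s * Theta (map g (insort x ys))"
      using Cons.IH by blast
    have comm: "f * (s * h) = s * (f * h)" for f h :: superpoly
      using s(1) by auto
    have "Theta (map g (x # y # ys)) = - s * Theta (map g (insort x (y # ys)))" for g
    proof -
      have "Theta (map g (x # y # ys)) = - (theta (g y) * Theta (map g (x # ys)))"
        using Theta_swap[of "[]" "g x" "g y" "map g ys"] by (simp add: Theta_Cons)
      then show ?thesis
        unfolding s(2) comm using False by (simp add: Theta_Cons)
    qed
    moreover have "- s \<in> {1, - 1}" using s(1) by auto
    ultimately show ?thesis by blast
  qed auto
qed auto

lemma Theta_sort:
  "\<exists>s\<in>{1, - 1}. \<forall>g. Theta (map g xs) = s * Theta (map g (sort xs))"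
proof (induction xs)
  case (Cons x xs)
  obtain s where s: "s \<in> {1, - 1}" "\<And>g. Theta (map g xs) = s * Theta (map g (sort xs))"
    using Cons.IH by blast
  obtain t where t: "t \<in> {1, - 1}"
      "\<And>g. Theta (map g (x # sort xs)) = t * Theta (map g (insort x (sort xs)))"
    using Theta_insort[of x "sort xs"] by blast
  have "Theta (map g (x # xs)) = s * t * Theta (map g (sort (x # xs)))" for g
  proof -
    have "Theta (map g (x # xs)) = s * Theta (map g (x # sort xs))"
      using s by (auto simp: Theta_Cons)
    then show ?thesis unfolding t(2) by (simp add: mult.assoc)
  qed
  moreover have "s * t \<in> {1, - 1}" using s(1) t(1) by auto
  ultimately show ?case by blast
qed auto

lemma Theta_sort_id:
  obtains s where "s \<in> {1, - 1}" "Theta xs = s * Theta (sort xs)"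
  using Theta_sort[of xs] by (metis list.map_id)

lemma coef_Theta_neq_0: "coef (Theta xs) K \<noteq> 0 \<Longrightarrow> distinct xs \<and> K = fset_of_list xs"
proof (induction xs arbitrary: K)
  case (Cons x xs)
  then have "x |\<in>| K" "coef (Theta xs) (K |-| {|x|}) \<noteq> 0"
    by (auto simp: Theta_Cons coef_theta_mult split: if_splits)
  then have "x |\<in>| K" "distinct xs" "K |-| {|x|} = fset_of_list xs" using Cons.IH by auto
  moreover from this have "x |\<notin>| fset_of_list xs" by (metis fminusD2 finsertI1)
  ultimately show ?case by (auto simp: fset_of_list_elem)
qed (simp add: coef_one split: if_splits)

lemma Theta_not_distinct: "\<not> distinct xs \<Longrightarrow> Theta xs = 0"
  by (rule superpoly_eqI) (use coef_Theta_neq_0 in fastforce)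

lemma sorted_wrt_less_sort: "distinct xs \<Longrightarrow> sorted_wrt (<) (sort (xs :: nat list))"
  by (simp add: strict_sorted_iff)

lemma coef_Theta_distinct:
  assumes "distinct xs"
  shows "coef (Theta xs) (fset_of_list xs) \<in> {1, - 1}"
proof -
  obtain s where s: "s \<in> {1, - 1}" "Theta xs = s * Theta (sort xs)" by (rule Theta_sort_id)
  have "fset_of_list (sort xs) = fset_of_list xs"
    by (metis fset_inject fset_of_list.rep_eq set_sort)
  then have "coef (Theta (sort xs)) (fset_of_list xs) = 1"
    by (simp add: coef_Theta_sorted[OF sorted_wrt_less_sort[OF assms]])
  then show ?thesis using s by auto
qed

lemma coef_Theta_cases: "coef (Theta xs) K \<in> {0, 1, - 1}"
  using coef_Theta_neq_0[of xs K] coef_Theta_distinct[of xs] by blast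

abbreviation fset_list :: "nat fset \<Rightarrow> nat list" where
  "fset_list I \<equiv> sorted_list_of_set (fset I)"

lemma fset_of_fset_list [simp]: "fset_of_list (fset_list I) = I"
  by (rule fset_inject[THEN iffD1]) (simp add: fset_of_list.rep_eq)

lemma coef_Theta_fset_list: "coef (Theta (fset_list I)) K = (if K = I then 1 else 0)"
  by (simp add: coef_Theta_sorted)

lemma superpoly_expand:
  "f = (\<Sum>I | coef f I \<noteq> 0. of_xpoly (coef f I) * Theta (fset_list I))"
proof (rule superpoly_eqI)
  fix K
  have "coef (\<Sum>I | coef f I \<noteq> 0. of_xpoly (coef f I) * Theta (fset_list I)) K
      = (\<Sum>I | coef f I \<noteq> 0. if K = I then coef f I else 0)"
    unfolding coef_sum by (rule sum.cong) (auto simp: coef_of_xpoly_mult coef_Theta_fset_list)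
  then show "coef f K = coef (\<Sum>I | coef f I \<noteq> 0. of_xpoly (coef f I) * Theta (fset_list I)) K"
    using finite_coef[of f] by (simp add: sum.delta')
qed

lemma superpoly_induct [case_names zero Theta add]:
  assumes "P 0" "\<And>p xs. sorted_wrt (<) xs \<Longrightarrow> P (of_xpoly p * Theta xs)"
    "\<And>f g. P f \<Longrightarrow> P g \<Longrightarrow> P (f + g)"
  shows "P f"
proof -
  have "P (\<Sum>I\<in>S. of_xpoly (coef f I) * Theta (fset_list I))" for S
    by (induction S rule: infinite_finite_induct) (auto intro!: assms)
  then show ?thesis by (metis superpoly_expand)
qed

lemma coef_coefwise:
  assumes "T 0 = 0"
  shows "coef (coefwise T f) I = T (coef f I)"
  using assms by (simp add: coefwise.rep_eq)

lemma coefwise_add: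
  assumes "\<And>p q. T (p + q) = T p + T q"
  shows "coefwise T (f + g) = coefwise T f + coefwise T g"
proof -
  have "T 0 = 0" using assms[of 0 0] by simp
  then show ?thesis by (intro superpoly_eqI) (simp add: coef_coefwise assms)
qed

lemma coefwise_Theta:
  assumes "\<And>p q. T (p + q) = T p + T q"
  shows "coefwise T (of_xpoly p * Theta xs) = of_xpoly (T p) * Theta xs"
proof -
  have T0: "T 0 = 0" using assms[of 0 0] by simp
  then have "T (- p) = - T p" using assms[of p "- p"] by (simp add: eq_neg_iff_add_eq_0 add.commute)
  then have "T (p * coef (Theta xs) K) = T p * coef (Theta xs) K" for K
    using coef_Theta_cases[of xs K] T0 by auto
  then show ?thesis
    by (intro superpoly_eqI) (simp add: coef_coefwise T0 coef_of_xpoly_mult)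
qed

section \<open>Simultaneous permutations of the variables\<close>

lemma super_perm_expand:
  assumes "finite S" "{I. coef f I \<noteq> 0} \<subseteq> S"
  shows "super_perm \<sigma> f
    = (\<Sum>I\<in>S. of_xpoly (x_subst \<sigma> (coef f I)) * Theta (map \<sigma> (fset_list I)))"
proof -
  have c: "coef (x_perm \<sigma> f) I = x_subst \<sigma> (coef f I)" for I
    by (simp add: x_perm_def coef_coefwise)
  have "super_perm \<sigma> f = (\<Sum>I | x_subst \<sigma> (coef f I) \<noteq> 0.
      of_xpoly (x_subst \<sigma> (coef f I)) * Theta (map \<sigma> (fset_list I)))"
    by (simp add: super_perm_def theta_perm_def c Theta_def comp_def)
  also have "\<dots> = (\<Sum>I\<in>S. of_xpoly (x_subst \<sigma> (coef f I)) * Theta (map \<sigma> (fset_list I)))"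
  proof (rule sum.mono_neutral_left[OF assms(1)])
    show "{I. x_subst \<sigma> (coef f I) \<noteq> 0} \<subseteq> S" using assms(2) by auto
  qed auto
  finally show ?thesis .
qed

lemma super_perm_zero [simp]: "super_perm \<sigma> 0 = 0"
  using super_perm_expand[of "{}" 0 \<sigma>] by simp

lemma super_perm_add: "super_perm \<sigma> (f + g) = super_perm \<sigma> f + super_perm \<sigma> g"
proof -
  let ?S = "{I. coef f I \<noteq> 0} \<union> {I. coef g I \<noteq> 0}"
  have "finite ?S" using finite_coef by simp
  moreover have "{I. coef (f + g) I \<noteq> 0} \<subseteq> ?S" by auto
  ultimately show ?thesis
    by (simp add: super_perm_expand[of ?S] x_subst_add of_xpoly_add distrib_right sum.distrib)
qed

lemma super_perm_uminus: "super_perm \<sigma> (- f) = - super_perm \<sigma> f"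
  using super_perm_add[of \<sigma> f "- f"] by (simp add: eq_neg_iff_add_eq_0 add.commute)

lemma super_perm_sum: "super_perm \<sigma> (\<Sum>i\<in>A. f i) = (\<Sum>i\<in>A. super_perm \<sigma> (f i))"
  by (induction A rule: infinite_finite_induct) (auto simp: super_perm_add)

lemma super_perm_Theta_sorted:
  assumes "sorted_wrt (<) xs"
  shows "super_perm \<sigma> (of_xpoly p * Theta xs) = of_xpoly (x_subst \<sigma> p) * Theta (map \<sigma> xs)"
proof -
  have "{I. coef (of_xpoly p * Theta xs) I \<noteq> 0} \<subseteq> {fset_of_list xs}"
    using assms by (auto simp: coef_of_xpoly_mult coef_Theta_sorted split: if_splits)
  moreover have "fset_list (fset_of_list xs) = xs"
    using assms by (simp add: fset_of_list.rep_eq strict_sorted_iff sorted_list_of_set.idem_if_sorted_distinct)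
  ultimately show ?thesis
    using assms by (simp add: super_perm_expand[of "{fset_of_list xs}"] coef_of_xpoly_mult coef_Theta_sorted)
qed

lemma super_perm_Theta:
  assumes "inj \<sigma>"
  shows "super_perm \<sigma> (of_xpoly p * Theta xs) = of_xpoly (x_subst \<sigma> p) * Theta (map \<sigma> xs)"
proof (cases "distinct xs")
  case True
  obtain s where s: "s \<in> {1, - 1}" "\<And>g. Theta (map g xs) = s * Theta (map g (sort xs))"
    using Theta_sort[of xs] by blast
  have "Theta xs = s * Theta (sort xs)" using s(2)[of id] by simp
  moreover have "super_perm \<sigma> (of_xpoly p * Theta (sort xs))
      = of_xpoly (x_subst \<sigma> p) * Theta (map \<sigma> (sort xs))"
    by (rule super_perm_Theta_sorted[OF sorted_wrt_less_sort[OF True]])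
  ultimately show ?thesis
    using s by (auto simp: super_perm_uminus)
next
  case False
  then have "\<not> distinct (map \<sigma> xs)" using assms by (simp add: distinct_map inj_on_subset)
  with False show ?thesis by (simp add: Theta_not_distinct)
qed

lemma super_perm_of_xpoly: "super_perm \<sigma> (of_xpoly p) = of_xpoly (x_subst \<sigma> p)"
  using super_perm_Theta_sorted[of "[]"] by simp

lemma super_perm_theta: "super_perm \<sigma> (theta i) = theta (\<sigma> i)"
  using super_perm_Theta_sorted[of "[i]" \<sigma> 1] by (simp add: Theta_Cons)

lemma Theta_term_mult:
  "(of_xpoly p * Theta xs) * (of_xpoly q * Theta ys) = of_xpoly (p * q) * Theta (xs @ ys)"
  by (simp add: of_xpoly_mult Theta_append mult.assoc)
    (metis mult.assoc of_xpoly_commute)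

lemma super_perm_mult:
  assumes "inj \<sigma>"
  shows "super_perm \<sigma> (f * g) = super_perm \<sigma> f * super_perm \<sigma> g"
proof (induction f rule: superpoly_induct)
  case (Theta p xs)
  show ?case
  proof (induction g rule: superpoly_induct)
    case (Theta q ys)
    show ?case
      by (simp only: Theta_term_mult super_perm_Theta[OF assms] x_subst_mult map_append)
  qed (simp_all add: super_perm_add distrib_left)
qed (simp_all add: super_perm_add distrib_right)

lemma super_perm_one [simp]: "super_perm \<sigma> 1 = 1"
  using super_perm_of_xpoly[of \<sigma> 1] by simp

lemma super_perm_prod_list:
  assumes "inj \<sigma>"
  shows "super_perm \<sigma> (prod_list fs) = prod_list (map (super_perm \<sigma>) fs)"
  by (induction fs) (simp_all add: super_perm_mult[OF assms])

lemma super_perm_scale: "inj \<sigma> \<Longrightarrow> super_perm \<sigma> (scale c f) = scale c (super_perm \<sigma> f)"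
  by (simp add: scale_def super_perm_mult super_perm_of_xpoly)

lemma super_perm_super_perm:
  assumes "inj \<sigma>" "inj \<tau>"
  shows "super_perm \<tau> (super_perm \<sigma> f) = super_perm (\<tau> \<circ> \<sigma>) f"
proof (induction f rule: superpoly_induct)
  case (Theta p xs)
  have "inj (\<tau> \<circ> \<sigma>)" using assms by (rule inj_compose[rotated])
  then show ?case
    by (simp only: super_perm_Theta assms x_subst_x_subst map_map)
qed (simp_all add: super_perm_add)

lemma super_perm_id [simp]: "super_perm id f = f"
proof (induction f rule: superpoly_induct)
  case (Theta p xs)
  then show ?case using x_subst_id[of p] by (simp add: super_perm_Theta)
qed (simp_all add: super_perm_add)

lemma super_perm_coefwise:
  assumes "inj \<sigma>" "\<And>p q. T (p + q) = T p + T q" "\<And>p q. T' (p + q) = T' p + T' q"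
    "\<And>p. x_subst \<sigma> (T p) = T' (x_subst \<sigma> p)"
  shows "super_perm \<sigma> (coefwise T f) = coefwise T' (super_perm \<sigma> f)"
proof (induction f rule: superpoly_induct)
  case zero
  have "T 0 = 0" using assms(2)[of 0 0] by simp
  moreover have "T' 0 = 0" using assms(3)[of 0 0] by simp
  ultimately have "coefwise T 0 = 0" "coefwise T' 0 = 0"
    by (auto intro!: superpoly_eqI simp: coef_coefwise)
  then show ?case by simp
next
  case (Theta p xs)
  then show ?case
    by (simp only: coefwise_Theta[OF assms(2)] coefwise_Theta[OF assms(3)]
        super_perm_Theta[OF assms(1)] assms(4))
qed (simp add: coefwise_add[OF assms(2)] coefwise_add[OF assms(3)] super_perm_add)

lemma coef_super_perm:
  assumes "inj \<sigma>"
  shows "coef (super_perm \<sigma> f) (\<sigma> |`| I)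
    = coef (Theta (map \<sigma> (fset_list I))) (\<sigma> |`| I) * x_subst \<sigma> (coef f I)"
proof -
  let ?S = "insert I {I. coef f I \<noteq> 0}"
  have fin: "finite ?S" using finite_coef by simp
  have *: "coef (Theta (map \<sigma> (fset_list J))) (\<sigma> |`| I) = 0" if "J \<noteq> I" for J
  proof (rule ccontr)
    assume "coef (Theta (map \<sigma> (fset_list J))) (\<sigma> |`| I) \<noteq> 0"
    then have "\<sigma> |`| I = fset_of_list (map \<sigma> (fset_list J))" using coef_Theta_neq_0 by blast
    then have "\<sigma> |`| I = \<sigma> |`| J" by simp
    then show False using that assms by (metis fset.inj_map injD)
  qed
  have "coef (super_perm \<sigma> f) (\<sigma> |`| I)
      = (\<Sum>J\<in>?S. x_subst \<sigma> (coef f J) * coef (Theta (map \<sigma> (fset_list J))) (\<sigma> |`| I))"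
    by (subst super_perm_expand[OF fin]) (auto simp: coef_sum coef_of_xpoly_mult)
  also have "\<dots> = (\<Sum>J\<in>{I}. x_subst \<sigma> (coef f J) * coef (Theta (map \<sigma> (fset_list J))) (\<sigma> |`| I))"
    by (rule sum.mono_neutral_right[OF fin]) (use * in auto)
  finally show ?thesis by (simp add: mult.commute)
qed

lemma coef_Theta_map_fset_list:
  assumes "inj \<sigma>"
  shows "coef (Theta (map \<sigma> (fset_list I))) (\<sigma> |`| I) \<in> {1, - 1}"
proof -
  have "distinct (map \<sigma> (fset_list I))"
    using assms by (auto simp: distinct_map intro: inj_on_subset)
  moreover have "fset_of_list (map \<sigma> (fset_list I)) = \<sigma> |`| I" by simp
  ultimately show ?thesis using coef_Theta_distinct by metis
qed

section \<open>Exponentials of locally nilpotent operators\<close>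

interpretation superpoly: vector_space_pair scale scale ..

abbreviation linear_op :: "(superpoly \<Rightarrow> superpoly) \<Rightarrow> bool" where
  "linear_op \<equiv> Vector_Spaces.linear scale scale"

lemma linear_opI:
  "(\<And>f g. T (f + g) = T f + T g) \<Longrightarrow> (\<And>c f. T (scale c f) = scale c (T f)) \<Longrightarrow> linear_op T"
  by (simp add: Vector_Spaces.linear_iff superpoly.vector_space_axioms)

context
  fixes T :: "superpoly \<Rightarrow> superpoly"
  assumes lin: "linear_op T" and nil: "\<And>f. \<exists>M. (T ^^ M) f = 0"
begin

lemma linear_funpow: "linear_op (T ^^ n)"
proof (induction n)
  case 0
  show ?case by (rule linear_opI) auto
next
  case (Suc n)
  show ?case
    using superpoly.linear_add[OF lin] superpoly.linear_scale[OF lin]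
      superpoly.linear_add[OF Suc] superpoly.linear_scale[OF Suc]
    by (intro linear_opI) auto
qed

lemma funpow_eq_0_mono:
  assumes "(T ^^ M) f = 0" "M \<le> n"
  shows "(T ^^ n) f = 0"
proof -
  have "(T ^^ n) f = (T ^^ (n - M)) ((T ^^ M) f)"
    using assms(2) by (metis comp_apply funpow_add le_add_diff_inverse2)
  then show ?thesis using assms(1) superpoly.linear_0[OF linear_funpow] by simp
qed

lemma exp_op_finite_sum:
  assumes "(T ^^ M) f = 0"
  shows "exp_op t T f = (\<Sum>n<M. scale (t ^ n / fact n) ((T ^^ n) f))"
  unfolding exp_op_def
proof (rule Sum_any.expand_superset)
  show "{n. scale (t ^ n / fact n) ((T ^^ n) f) \<noteq> 0} \<subseteq> {..<M}"
  proof
    fix n assume "n \<in> {n. scale (t ^ n / fact n) ((T ^^ n) f) \<noteq> 0}"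
    then have "(T ^^ n) f \<noteq> 0" using superpoly.scale_zero_right by auto
    then show "n \<in> {..<M}" using funpow_eq_0_mono[OF assms, of n] by (metis lessThan_iff not_le_imp_less)
  qed
qed simp

lemma linear_exp_op: "linear_op (exp_op t T)"
proof (rule linear_opI)
  fix f g
  obtain M1 M2 where M: "(T ^^ M1) f = 0" "(T ^^ M2) g = 0" using nil by blast
  define M where "M = max M1 M2"
  have z: "(T ^^ M) f = 0" "(T ^^ M) g = 0"
    by (rule funpow_eq_0_mono[OF M(1)], simp add: M_def,
        rule funpow_eq_0_mono[OF M(2)], simp add: M_def)
  then have z': "(T ^^ M) (f + g) = 0" using superpoly.linear_add[OF linear_funpow] by simp
  show "exp_op t T (f + g) = exp_op t T f + exp_op t T g"
    by (simp only: exp_op_finite_sum[OF z(1)] exp_op_finite_sum[OF z(2)] exp_op_finite_sum[OF z'] superpoly.linear_add[OF linear_funpow]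
        superpoly.scale_right_distrib sum.distrib)
next
  fix c f
  obtain M where z: "(T ^^ M) f = 0" using nil by blast
  then have z': "(T ^^ M) (scale c f) = 0" using superpoly.linear_scale[OF linear_funpow] by simp
  show "exp_op t T (scale c f) = scale c (exp_op t T f)"
    by (simp only: exp_op_finite_sum[OF z] exp_op_finite_sum[OF z'] superpoly.linear_scale[OF linear_funpow]
        superpoly.scale_sum_right superpoly.scale_left_commute[of _ c])
qed

lemma exp_op_add: "exp_op s T (exp_op t T f) = exp_op (s + t) T f"
proof -
  obtain M where M: "(T ^^ M) f = 0" using nil by blast
  define a where "a m n = scale (s ^ m / fact m * (t ^ n / fact n)) ((T ^^ (m + n)) f)" for m n
  have a0: "a m n = 0" if "M \<le> m + n" for m n
    unfolding a_def using funpow_eq_0_mono[OF M that] by simp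
  have t1: "exp_op s T ((T ^^ n) f) = (\<Sum>m<M. scale (s ^ m / fact m) ((T ^^ m) ((T ^^ n) f)))" for n
  proof (rule exp_op_finite_sum)
    show "(T ^^ M) ((T ^^ n) f) = 0"
      using funpow_eq_0_mono[OF M, of "M + n"] by (simp add: funpow_add)
  qed
  have "exp_op s T (exp_op t T f) = (\<Sum>n<M. scale (t ^ n / fact n) (exp_op s T ((T ^^ n) f)))"
    unfolding exp_op_finite_sum[OF M, of t]
    by (simp add: superpoly.linear_sum[OF linear_exp_op] superpoly.linear_scale[OF linear_exp_op])
  also have "\<dots> = (\<Sum>n<M. \<Sum>m<M. a m n)"
    by (simp add: t1 superpoly.scale_sum_right a_def funpow_add mult.commute)
  also have "\<dots> = (\<Sum>m<M. \<Sum>n<M. a m n)" by (rule sum.swap)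
  also have "\<dots> = (\<Sum>(m, n)\<in>{..<M} \<times> {..<M}. a m n)" by (rule sum.cartesian_product)
  also have "\<dots> = (\<Sum>(m, n)\<in>{(m, n). m + n < M}. a m n)"
    by (rule sum.mono_neutral_right) (use a0 not_less in auto)
  also have "\<dots> = (\<Sum>k<M. \<Sum>i\<le>k. a i (k - i))" by (rule sum.triangle_reindex)
  also have "\<dots> = (\<Sum>k<M. scale ((s + t) ^ k / fact k) ((T ^^ k) f))"
  proof (rule sum.cong[OF refl])
    fix k
    have c: "s ^ i / fact i * (t ^ (k - i) / fact (k - i))
        = of_nat (k choose i) * s ^ i * t ^ (k - i) / fact k" if "i \<le> k" for i
      using that by (simp add: binomial_fact)
    have "(\<Sum>i\<le>k. a i (k - i))
        = (\<Sum>i\<le>k. scale (s ^ i / fact i * (t ^ (k - i) / fact (k - i))) ((T ^^ k) f))"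
      by (rule sum.cong) (auto simp: a_def)
    also have "\<dots> = scale (\<Sum>i\<le>k. s ^ i / fact i * (t ^ (k - i) / fact (k - i))) ((T ^^ k) f)"
      by (rule superpoly.scale_sum_left[symmetric])
    also have "(\<Sum>i\<le>k. s ^ i / fact i * (t ^ (k - i) / fact (k - i)))
        = (\<Sum>i\<le>k. of_nat (k choose i) * s ^ i * t ^ (k - i) / fact k)"
      by (rule sum.cong[OF refl], rule c) simp
    also have "\<dots> = (s + t) ^ k / fact k"
      by (simp only: binomial_ring sum_divide_distrib)
    finally show "(\<Sum>i\<le>k. a i (k - i)) = scale ((s + t) ^ k / fact k) ((T ^^ k) f)" .
  qed
  also have "\<dots> = exp_op (s + t) T f" by (rule exp_op_finite_sum[OF M, symmetric])
  finally show ?thesis .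
qed

lemma exp_op_zero: "exp_op 0 T f = f"
proof -
  obtain M where M: "(T ^^ Suc M) f = 0" using nil funpow_eq_0_mono by (meson le_Suc_eq le_refl)
  show ?thesis unfolding exp_op_finite_sum[OF M] by (simp only: sum.lessThan_Suc_shift) simp
qed

lemma exp_op_cancel: "exp_op (- t) T (exp_op t T f) = f"
  by (simp add: exp_op_add exp_op_zero)

lemma exp_op_minus_id_mem:
  assumes "superpoly.subspace W" "\<And>n. 1 \<le> n \<Longrightarrow> (T ^^ n) f \<in> W"
  shows "exp_op t T f - f \<in> W"
proof -
  obtain M where M: "(T ^^ Suc M) f = 0" using nil funpow_eq_0_mono by (meson le_Suc_eq le_refl)
  have "exp_op t T f - f = (\<Sum>n<M. scale (t ^ Suc n / fact (Suc n)) ((T ^^ Suc n) f))"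
    unfolding exp_op_finite_sum[OF M] by (simp only: sum.lessThan_Suc_shift) simp
  also have "\<dots> \<in> W"
    by (intro superpoly.subspace_sum superpoly.subspace_scale assms) auto
  finally show ?thesis .
qed

lemma exp_op_mem:
  assumes "superpoly.subspace W" "\<And>g. g \<in> W \<Longrightarrow> T g \<in> W" "f \<in> W"
  shows "exp_op t T f \<in> W"
proof -
  have "(T ^^ n) f \<in> W" for n by (induction n) (auto intro: assms)
  then have "exp_op t T f - f \<in> W" by (intro exp_op_minus_id_mem assms)
  then show ?thesis using superpoly.subspace_add[OF assms(1) _ assms(3)] by force
qed

end

section \<open>The Dunkl Laplacian\<close>

lemma linear_coefwise:
  assumes "\<And>p q. T (p + q) = T p + T q" "\<And>c p. T (cst c * p) = cst c * T p"
  shows "linear_op (coefwise T)"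
proof -
  have "T 0 = 0" using assms(1)[of 0 0] by simp
  then show ?thesis
    by (intro linear_opI coefwise_add assms) (auto intro!: superpoly_eqI simp: coef_coefwise coef_scale assms)
qed

lemma linear_dunkl: "linear_op (coefwise (dunkl N \<beta> j))"
  by (rule linear_coefwise) (fact dunkl_add dunkl_scale)+

lemma linear_Laplacian: "linear_op (Laplacian N \<beta>)"
  by (rule linear_opI) (simp_all add: Laplacian_def superpoly.linear_add[OF linear_dunkl]
      superpoly.linear_scale[OF linear_dunkl] sum.distrib superpoly.scale_sum_right)

definition degrees_in :: "nat set \<Rightarrow> superpoly set" where
  "degrees_in D = {f. \<forall>I. coef f I \<in> x_graded UNIV D}"

lemma cst_mult_graded:
  assumes "p \<in> x_graded V D"
  shows "cst c * p \<in> x_graded V D"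
  using assms
  by (induction rule: x_graded_induct)
    (auto simp: cst_mult_single distrib_left intro: x_graded_single x_graded_add)

lemma subspace_degrees_in: "superpoly.subspace (degrees_in D)"
  by (rule superpoly.subspaceI)
    (auto simp: degrees_in_def coef_scale intro: x_graded_add cst_mult_graded)

lemma degrees_in_empty: "degrees_in {} = {0}"
proof -
  have "f = 0" if "f \<in> degrees_in {}" for f
  proof (rule superpoly_eqI)
    fix I
    have "Poly_Mapping.keys (coef f I) = {}"
      using that by (auto simp: degrees_in_def x_graded_def)
    then show "coef f I = coef 0 I" by (simp add: poly_mapping_eqI in_keys_iff)
  qed
  then show ?thesis by (auto simp: degrees_in_def)
qed

lemma degrees_in_mono: "D \<subseteq> E \<Longrightarrow> degrees_in D \<subseteq> degrees_in E"
  by (auto simp: degrees_in_def x_graded_def)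

lemma degrees_in_bounded: "\<exists>M. f \<in> degrees_in {..<M}"
proof -
  let ?S = "\<Union>I\<in>{I. coef f I \<noteq> 0}. total ` Poly_Mapping.keys (coef f I)"
  have "finite ?S" by (intro finite_UN_I finite_coef) auto
  then obtain M where M: "\<forall>d\<in>?S. d < M" using finite_nat_set_iff_bounded by blast
  have "total e < M" if "e \<in> Poly_Mapping.keys (coef f I)" for I e
  proof -
    have "coef f I \<noteq> 0" using that by auto
    with that have "total e \<in> ?S" by auto
    then show ?thesis using M by (rule bspec[rotated])
  qed
  then have "f \<in> degrees_in {..<M}" by (auto simp: degrees_in_def x_graded_def)
  then show ?thesis ..
qed

lemma coef_dunkl: "coef (coefwise (dunkl N \<beta> j) f) I = dunkl N \<beta> j (coef f I)"
  using dunkl_add[of N \<beta> j 0 0] by (simp add: coef_coefwise)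

lemma Laplacian_degrees_in:
  assumes "f \<in> degrees_in D"
  shows "Laplacian N \<beta> f \<in> degrees_in {d. d + 2 \<in> D}"
proof -
  have "dunkl N \<beta> j (dunkl N \<beta> j (coef f I)) \<in> x_graded UNIV {d. d + 2 \<in> D}" for j I
  proof (rule x_graded_mono)
    show "dunkl N \<beta> j (dunkl N \<beta> j (coef f I)) \<in> x_graded UNIV {d. Suc d \<in> {d. Suc d \<in> D}}"
      using assms by (intro x_graded_dunkl) (auto simp: degrees_in_def)
  qed auto
  then show ?thesis
    by (auto simp: degrees_in_def Laplacian_def coef_sum coef_dunkl intro: x_graded_sum)
qed

lemma Laplacian_funpow_degrees_in:
  "f \<in> degrees_in D \<Longrightarrow> (Laplacian N \<beta> ^^ n) f \<in> degrees_in {d. d + 2 * n \<in> D}"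
proof (induction n)
  case (Suc n)
  show ?case
    using Laplacian_degrees_in[OF Suc.IH[OF Suc.prems]] by simp
qed simp

lemma Laplacian_nilpotent: "\<exists>M. (Laplacian N \<beta> ^^ M) f = 0"
proof -
  obtain M where "f \<in> degrees_in {..<M}" using degrees_in_bounded by blast
  then have "(Laplacian N \<beta> ^^ M) f \<in> degrees_in {d. d + 2 * M \<in> {..<M}}"
    by (rule Laplacian_funpow_degrees_in)
  then show ?thesis by (auto simp: degrees_in_empty)
qed

lemma superpolys_iff:
  "f \<in> superpolys N \<longleftrightarrow>
     (\<forall>I. coef f I \<noteq> 0 \<longrightarrow> fset I \<subseteq> {1..N} \<and> coef f I \<in> x_graded {1..N} UNIV)"
  by (simp add: superpolys_def x_graded_def)

lemma coef_superpolys_graded: "f \<in> superpolys N \<Longrightarrow> coef f I \<in> x_graded {1..N} UNIV"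
  by (cases "coef f I = 0") (auto simp: superpolys_iff)

lemma subspace_superpolys: "superpoly.subspace (superpolys N)"
proof (rule superpoly.subspaceI)
  fix f g assume f: "f \<in> superpolys N" and g: "g \<in> superpolys N"
  show "f + g \<in> superpolys N"
    unfolding superpolys_iff
  proof (intro allI impI conjI)
    fix I assume "coef (f + g) I \<noteq> 0"
    then have "coef f I \<noteq> 0 \<or> coef g I \<noteq> 0" by auto
    then show "fset I \<subseteq> {1..N}" using f g unfolding superpolys_iff by blast
    show "coef (f + g) I \<in> x_graded {1..N} UNIV"
      using coef_superpolys_graded[OF f] coef_superpolys_graded[OF g] by (simp add: x_graded_add)
  qed
next
  fix c f assume f: "f \<in> superpolys N"
  show "scale c f \<in> superpolys N"
    unfolding superpolys_iff
  proof (intro allI impI conjI)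
    fix I assume "coef (scale c f) I \<noteq> 0"
    then have "coef f I \<noteq> 0" by (auto simp: coef_scale)
    then show "fset I \<subseteq> {1..N}" using f unfolding superpolys_iff by blast
    show "coef (scale c f) I \<in> x_graded {1..N} UNIV"
      using coef_superpolys_graded[OF f] by (simp add: coef_scale cst_mult_graded)
  qed
qed (simp add: superpolys_iff)

lemma subspace_sym_superpolys: "superpoly.subspace (sym_superpolys N)"
proof (rule superpoly.subspaceI)
  show "0 \<in> sym_superpolys N"
    by (simp add: sym_superpolys_def superpolys_iff)
  fix f assume f: "f \<in> sym_superpolys N"
  show "f + g \<in> sym_superpolys N" if "g \<in> sym_superpolys N" for g
    using f that superpoly.subspace_add[OF subspace_superpolys]
    by (simp add: sym_superpolys_def super_perm_add)
  show "scale c f \<in> sym_superpolys N" for c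
    using f superpoly.subspace_scale[OF subspace_superpolys]
    by (simp add: sym_superpolys_def super_perm_scale)
qed

lemma Laplacian_superpolys:
  assumes "f \<in> superpolys N"
  shows "Laplacian N \<beta> f \<in> superpolys N"
  unfolding Laplacian_def
proof (rule superpoly.subspace_sum[OF subspace_superpolys])
  fix j assume "j \<in> {1..N}"
  have "coefwise (dunkl N \<beta> j) g \<in> superpolys N" if g: "g \<in> superpolys N" for g
    unfolding superpolys_iff coef_dunkl
  proof (intro allI impI conjI)
    fix I assume "dunkl N \<beta> j (coef g I) \<noteq> 0"
    then have "coef g I \<noteq> 0" using dunkl_add[of N \<beta> j 0 0] by auto
    then show "fset I \<subseteq> {1..N}" using g unfolding superpolys_iff by blast
    have "dunkl N \<beta> j (coef g I) \<in> x_graded {1..N} {d. Suc d \<in> UNIV}"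
      using \<open>j \<in> {1..N}\<close> by (intro x_graded_dunkl coef_superpolys_graded[OF g]) auto
    then show "dunkl N \<beta> j (coef g I) \<in> x_graded {1..N} UNIV" by simp
  qed
  then show "coefwise (dunkl N \<beta> j) (coefwise (dunkl N \<beta> j) f) \<in> superpolys N"
    using assms by blast
qed

lemma super_perm_Laplacian:
  assumes "\<sigma> permutes {1..N}"
  shows "super_perm \<sigma> (Laplacian N \<beta> f) = Laplacian N \<beta> (super_perm \<sigma> f)"
proof -
  have *: "super_perm \<sigma> (coefwise (dunkl N \<beta> j) g)
      = coefwise (dunkl N \<beta> (\<sigma> j)) (super_perm \<sigma> g)" for j g
    by (intro super_perm_coefwise permutes_inj[OF assms] dunkl_add x_subst_dunkl[OF assms])
  have "super_perm \<sigma> (Laplacian N \<beta> f) = (\<Sum>j\<in>{1..N}. coefwise (dunkl N \<beta> (\<sigma> j))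
      (coefwise (dunkl N \<beta> (\<sigma> j)) (super_perm \<sigma> f)))"
    by (simp add: Laplacian_def super_perm_sum *)
  also have "\<dots> = (\<Sum>j\<in>{1..N}. coefwise (dunkl N \<beta> j) (coefwise (dunkl N \<beta> j) (super_perm \<sigma> f)))"
    by (rule sum.reindex_bij_betw[OF permutes_imp_bij[OF assms]])
  finally show ?thesis by (simp add: Laplacian_def)
qed

lemma Laplacian_sym_superpolys:
  assumes "f \<in> sym_superpolys N"
  shows "Laplacian N \<beta> f \<in> sym_superpolys N"
  using assms Laplacian_superpolys
  by (auto simp: sym_superpolys_def super_perm_Laplacian permutes_swap_id)

lemma lookup_cst_mult: "Poly_Mapping.lookup (cst c * p) e = c * Poly_Mapping.lookup p e"
  by (induction p rule: xpoly_induct)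
    (auto simp: cst_mult_single lookup_single when_def distrib_left lookup_add)

lemma coef_x_euler: "coef (coefwise (x_euler N) f) I = x_euler N (coef f I)"
  by (rule coef_coefwise) (simp add: x_euler_def)

lemma x_euler_degrees_in:
  assumes "f \<in> superpolys N" "f \<in> degrees_in {d}"
  shows "coefwise (x_euler N) f = scale (of_nat d) f"
proof (rule superpoly_eqI, rule poly_mapping_eqI)
  fix I e
  have "Poly_Mapping.lookup (coef f I) e \<noteq> 0 \<Longrightarrow> total e = d"
    using assms(2) by (auto simp: degrees_in_def x_graded_def in_keys_iff)
  then show "Poly_Mapping.lookup (coef (coefwise (x_euler N) f) I) e
      = Poly_Mapping.lookup (coef (scale (of_nat d) f) I) e"
    using lookup_x_euler[OF coef_superpolys_graded[OF assms(1)], of I e]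
    by (auto simp: coef_x_euler coef_scale lookup_cst_mult)
qed

lemma x_euler_eigen_degrees_in:
  assumes "f \<in> superpolys N" "coefwise (x_euler N) f = scale (of_nat d) f"
  shows "f \<in> degrees_in {d}"
  unfolding degrees_in_def x_graded_def
proof (intro CollectI allI ballI conjI)
  fix I e assume e: "e \<in> Poly_Mapping.keys (coef f I)"
  have "Poly_Mapping.lookup (x_euler N (coef f I)) e
      = Poly_Mapping.lookup (cst (of_nat d) * coef f I) e"
    using arg_cong[OF assms(2), of "\<lambda>g. Poly_Mapping.lookup (coef g I) e"]
    by (simp only: coef_x_euler coef_scale)
  then have "of_nat (total e) * Poly_Mapping.lookup (coef f I) e
      = of_nat d * Poly_Mapping.lookup (coef f I) e"
    using lookup_x_euler[OF coef_superpolys_graded[OF assms(1)], of I e] by (simp add: lookup_cst_mult)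
  then show "total e \<in> {d}" using e by (simp add: in_keys_iff)
qed auto

section \<open>Leading coefficients of symmetric superpolynomials\<close>

definition firsts :: "nat \<Rightarrow> nat fset" where
  "firsts m = fset_of_list [1..<Suc m]"

lemma fset_firsts [simp]: "fset (firsts m) = {1..m}"
  by (auto simp: firsts_def fset_of_list.rep_eq)

lemma firsts_inject [simp]: "firsts m = firsts n \<longleftrightarrow> m = n"
  by (metis card_atLeastAtMost diff_Suc_1 fset_firsts)

lemma fset_list_firsts: "fset_list (firsts m) = [1..<Suc m]"
proof -
  have "{1..m} = set [1..<Suc m]" by auto
  then show ?thesis by (metis fset_firsts sorted_list_of_set.idem_if_sorted_distinct sorted_upt distinct_upt)
qed

definition expo :: "nat list \<Rightarrow> nat \<Rightarrow>\<^sub>0 nat" where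
  "expo L = (\<Sum>i=1..length L. Poly_Mapping.single i (L ! (i - 1)))"

lemma lookup_expo:
  "Poly_Mapping.lookup (expo L) i = (if 1 \<le> i \<and> i \<le> length L then L ! (i - 1) else 0)"
  by (simp add: expo_def lookup_sum lookup_single when_def)

lemma total_expo: "total (expo L) = sum_list L"
proof -
  have "total (expo L) = (\<Sum>i=1..length L. L ! (i - 1))"
    by (simp add: expo_def total_sum)
  also have "\<dots> = (\<Sum>i=0..<length L. L ! i)"
    by (rule sum.reindex_bij_witness[where i = Suc and j = "\<lambda>i. i - 1"]) auto
  finally show ?thesis by (simp add: sum_list_sum_nth)
qed

lemma keys_expo: "Poly_Mapping.keys (expo L) \<subseteq> {1..length L}"
  by (auto simp: in_keys_iff lookup_expo split: if_splits)

lemma expo_inject: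
  assumes "expo L = expo L'" "length L = length L'"
  shows "L = L'"
proof (rule nth_equalityI[OF assms(2)])
  fix i assume "i < length L"
  then show "L ! i = L' ! i"
    using arg_cong[OF assms(1), of "\<lambda>e. Poly_Mapping.lookup e (Suc i)"] assms(2)
    by (simp add: lookup_expo)
qed

definition lead :: "superpartition \<Rightarrow> superpoly \<Rightarrow> complex" where
  "lead \<Lambda> f = Poly_Mapping.lookup (coef f (firsts (length (fst \<Lambda>)))) (expo (entries \<Lambda>))"

lemma lead_zero [simp]: "lead \<Lambda> 0 = 0"
  and lead_add: "lead \<Lambda> (f + g) = lead \<Lambda> f + lead \<Lambda> g"
  and lead_diff: "lead \<Lambda> (f - g) = lead \<Lambda> f - lead \<Lambda> g"
  and lead_scale: "lead \<Lambda> (scale c f) = c * lead \<Lambda> f"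
  by (simp_all add: lead_def lookup_add lookup_minus coef_scale lookup_cst_mult)

lemma lead_sum: "lead \<Lambda> (\<Sum>i\<in>A. f i) = (\<Sum>i\<in>A. lead \<Lambda> (f i))"
  by (induction A rule: infinite_finite_induct) (auto simp: lead_add)

lemma degree_lead: "f \<in> degrees_in D \<Longrightarrow> lead \<Lambda> f \<noteq> 0 \<Longrightarrow> degree \<Lambda> \<in> D"
  unfolding degrees_in_def x_graded_def lead_def degree_def
  by (auto simp: in_keys_iff simp flip: total_expo)

lemma finite_lead: "finite {\<Lambda> \<in> superpartitions N. lead \<Lambda> f \<noteq> 0}"
proof (rule finite_imageD)
  let ?g = "\<lambda>\<Lambda>. (firsts (length (fst \<Lambda>)), expo (entries \<Lambda>))"
  let ?S = "{\<Lambda> \<in> superpartitions N. lead \<Lambda> f \<noteq> 0}"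
  have "?g ` ?S \<subseteq> Sigma {I. coef f I \<noteq> 0} (\<lambda>I. Poly_Mapping.keys (coef f I))"
    by (auto simp: lead_def in_keys_iff)
  then show "finite (?g ` ?S)"
    by (rule finite_subset) (use finite_coef in auto)
  show "inj_on ?g ?S"
  proof (rule inj_onI)
    fix x y assume xy: "x \<in> ?S" "y \<in> ?S" "?g x = ?g y"
    then have l: "length (entries x) = length (entries y)"
      by (auto simp: superpartitions_def entries_def)
    have "entries x = entries y" using xy(3) by (intro expo_inject[OF _ l]) simp
    moreover have "length (fst x) = length (fst y)" using xy(3) by simp
    ultimately show "x = y" by (auto simp: entries_def intro: prod_eqI)
  qed
qed

lemma sym_superpolys_super_perm:
  assumes "f \<in> sym_superpolys N" "\<sigma> permutes {1..N}"
  shows "super_perm \<sigma> f = f"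
  using assms(2) finite_atLeastAtMost
proof (induction rule: permutes_induct)
  case (swap a b p)
  have "super_perm (transpose a b \<circ> p) f = super_perm (transpose a b) (super_perm p f)"
    by (rule super_perm_super_perm[symmetric]) (use swap permutes_inj in auto)
  also have "\<dots> = f" using swap assms(1) by (simp add: sym_superpolys_def)
  finally show ?case .
qed (rule super_perm_id)

lemma relabel_transpose_same:
  assumes "Poly_Mapping.lookup e i = Poly_Mapping.lookup e j"
  shows "relabel (transpose i j) e = e"
proof (rule poly_mapping_eqI)
  fix k
  have "Poly_Mapping.lookup (relabel (transpose i j) e) (transpose i j (transpose i j k))
      = Poly_Mapping.lookup e (transpose i j k)"
    by (rule lookup_relabel) simp
  then show "Poly_Mapping.lookup (relabel (transpose i j) e) k = Poly_Mapping.lookup e k"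
    using assms by (auto simp: transpose_def split: if_splits)
qed

lemma sym_superpolys_antisymmetric:
  assumes f: "f \<in> sym_superpolys N" and i: "1 \<le> i" "Suc i \<le> m" "m \<le> N"
    and e: "Poly_Mapping.lookup e i = Poly_Mapping.lookup e (Suc i)"
  shows "Poly_Mapping.lookup (coef f (firsts m)) e = 0"
proof -
  let ?t = "transpose i (Suc i)"
  have img: "?t |`| firsts m = firsts m"
  proof (rule fset_inject[THEN iffD1])
    have "?t ` {1..m} = {1..m}"
      by (rule permutes_image[OF permutes_swap_id]) (use i in auto)
    then show "fset (?t |`| firsts m) = fset (firsts m)" by simp
  qed
  have split: "[1..<Suc m] = [1..<i] @ [i, Suc i] @ [Suc (Suc i)..<Suc m]"
    using i upt_add_eq_append[of 1 i "Suc m - i"] by (simp add: upt_conv_Cons)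
  have "map ?t [1..<i] = [1..<i]" "map ?t [Suc (Suc i)..<Suc m] = [Suc (Suc i)..<Suc m]"
    by (auto intro!: map_idI)
  then have "map ?t [1..<Suc m] = [1..<i] @ [Suc i, i] @ [Suc (Suc i)..<Suc m]"
    unfolding split by simp
  then have neg: "Theta (map ?t [1..<Suc m]) = - Theta [1..<Suc m]"
    unfolding split by (metis Theta_swap)
  have sgn: "coef (Theta (map ?t (fset_list (firsts m)))) (firsts m) = - 1"
    unfolding fset_list_firsts neg
    using coef_Theta_fset_list[of "firsts m" "firsts m", unfolded fset_list_firsts]
    by (simp del: upt_Suc)
  have "super_perm ?t f = f"
    using f i by (simp add: sym_superpolys_def)
  then have "coef f (firsts m) = - x_subst ?t (coef f (firsts m))"
    using coef_super_perm[of ?t f "firsts m"] unfolding img sgn by simp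
  then have "Poly_Mapping.lookup (coef f (firsts m)) e
      = - Poly_Mapping.lookup (x_subst ?t (coef f (firsts m))) (relabel ?t e)"
    using relabel_transpose_same[OF e] by (metis lookup_uminus)
  also have "\<dots> = - Poly_Mapping.lookup (coef f (firsts m)) e"
    by (subst lookup_x_subst) auto
  finally show ?thesis by simp
qed

text \<open>Sorting the exponents of any monomial of a symmetric superpolynomial, separately over the
  indices inside and outside its \<open>\<theta>\<close>-part, gives a monomial of a superpartition.\<close>

lemma sym_superpolys_lead:
  assumes f: "f \<in> sym_superpolys N" and "f \<noteq> 0"
  obtains \<Lambda> where "\<Lambda> \<in> superpartitions N" "lead \<Lambda> f \<noteq> 0"
proof -
  have fs: "f \<in> superpolys N" using f by (simp add: sym_superpolys_def)
  obtain I where I: "coef f I \<noteq> 0" using assms(2) superpoly_eqI[of f 0] by auto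
  then obtain e where e: "Poly_Mapping.lookup (coef f I) e \<noteq> 0"
    using poly_mapping_eqI[of "coef f I" 0] by auto
  have IN: "fset I \<subseteq> {1..N}" using I fs unfolding superpolys_iff by blast
  have eN: "Poly_Mapping.keys e \<subseteq> {1..N}"
    using coef_superpolys_graded[OF fs, of I] e by (auto simp: x_graded_def in_keys_iff)
  define ex where "ex = Poly_Mapping.lookup e"
  define xs where "xs = rev (sort_key ex (fset_list I))"
  define ys where "ys = rev (sort_key ex (sorted_list_of_set ({1..N} - fset I)))"
  define zs where "zs = xs @ ys"
  have sxs: "set xs = fset I" "distinct xs" by (simp_all add: xs_def)
  have sys: "set ys = {1..N} - fset I" "distinct ys" by (simp_all add: ys_def)
  have zs: "set zs = {1..N}" "distinct zs" using sxs sys IN by (auto simp: zs_def)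
  have lz: "length zs = N" using distinct_card[OF zs(2)] zs(1) by simp
  define \<pi> where "\<pi> k = (if k \<in> {1..N} then zs ! (k - 1) else k)" for k
  have "bij_betw (\<lambda>k. zs ! (k - 1)) {1..N} {1..N}"
  proof (rule bij_betw_imageI)
    show "inj_on (\<lambda>k. zs ! (k - 1)) {1..N}"
      using zs(2) lz by (auto simp: inj_on_def nth_eq_iff_index_eq)
    show "(\<lambda>k. zs ! (k - 1)) ` {1..N} = {1..N}"
    proof
      show "(\<lambda>k. zs ! (k - 1)) ` {1..N} \<subseteq> {1..N}"
        using zs(1) lz nth_mem[of _ zs] by fastforce
      show "{1..N} \<subseteq> (\<lambda>k. zs ! (k - 1)) ` {1..N}"
      proof
        fix x assume "x \<in> {1..N}"
        then obtain k where "k < N" "zs ! k = x" using zs(1) lz by (metis in_set_conv_nth)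
        then show "x \<in> (\<lambda>k. zs ! (k - 1)) ` {1..N}" by (intro image_eqI[of _ _ "Suc k"]) auto
      qed
    qed
  qed
  then have "bij_betw \<pi> {1..N} {1..N}"
    by (subst bij_betw_cong[where g = "\<lambda>k. zs ! (k - 1)"]) (auto simp: \<pi>_def)
  then have perm: "\<pi> permutes {1..N}"
    by (rule bij_imp_permutes) (auto simp: \<pi>_def)
  note inj = permutes_inj[OF perm]
  define A B where "A = map ex xs" and "B = map ex ys"
  let ?I = "firsts (length A)" and ?e = "expo (A @ B)"
  have lA: "length A \<le> N" using lz by (simp add: A_def zs_def)
  have imgI: "\<pi> |`| ?I = I"
  proof (rule fset_inject[THEN iffD1])
    have "\<pi> ` {1..length A} = set xs"
    proof
      show "\<pi> ` {1..length A} \<subseteq> set xs"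
        using lA by (auto simp: \<pi>_def zs_def A_def nth_append)
      show "set xs \<subseteq> \<pi> ` {1..length A}"
      proof
        fix x assume "x \<in> set xs"
        then obtain k where "k < length xs" "xs ! k = x" by (metis in_set_conv_nth)
        then show "x \<in> \<pi> ` {1..length A}"
          using lA by (intro image_eqI[of _ _ "Suc k"]) (auto simp: \<pi>_def zs_def A_def nth_append)
      qed
    qed
    then show "fset (\<pi> |`| ?I) = fset I" by (simp add: sxs)
  qed
  have ek: "A @ B = map ex zs" by (simp add: A_def B_def zs_def)
  have e': "relabel \<pi> ?e = e"
  proof (rule poly_mapping_eqI)
    fix x
    obtain k where k: "x = \<pi> k" using permutes_surj[OF perm] by (metis surjD)
    have "Poly_Mapping.lookup ?e k = ex (\<pi> k)"
    proof (cases "k \<in> {1..N}")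
      case True
      then have "k - 1 < length zs" by (simp add: lz) linarith
      with True show ?thesis by (simp add: lookup_expo ek lz \<pi>_def)
    next
      case False
      then have "ex k = 0" using eN by (auto simp: ex_def in_keys_iff)
      with False show ?thesis by (auto simp: lookup_expo ek lz \<pi>_def)
    qed
    then show "Poly_Mapping.lookup (relabel \<pi> ?e) x = Poly_Mapping.lookup e x"
      by (simp add: k lookup_relabel[OF inj] ex_def)
  qed
  have "coef f I = coef (Theta (map \<pi> (fset_list ?I))) (\<pi> |`| ?I) * x_subst \<pi> (coef f ?I)"
    using coef_super_perm[OF inj, of f ?I] sym_superpolys_super_perm[OF f perm] by (simp add: imgI)
  moreover have "coef (Theta (map \<pi> (fset_list ?I))) (\<pi> |`| ?I) \<in> {1, - 1}"
    by (rule coef_Theta_map_fset_list[OF inj])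
  ultimately have "Poly_Mapping.lookup (x_subst \<pi> (coef f ?I)) (relabel \<pi> ?e) \<noteq> 0"
    using e by (auto simp: e')
  then have ne: "Poly_Mapping.lookup (coef f ?I) ?e \<noteq> 0"
    by (simp add: lookup_x_subst[OF inj])
  have sorted: "sorted_wrt (\<ge>) (map ex (rev (sort_key ex l)))" for l
    by (simp add: sorted_wrt_rev flip: rev_map)
  have "A ! k > A ! Suc k" if "Suc k < length A" for k
  proof -
    have "A ! k \<ge> A ! Suc k"
      using sorted[of "fset_list I"] that
      unfolding A_def xs_def by (meson lessI sorted_wrt_nth_less)
    moreover have "A ! k \<noteq> A ! Suc k"
    proof
      assume "A ! k = A ! Suc k"
      then have "Poly_Mapping.lookup ?e (Suc k) = Poly_Mapping.lookup ?e (Suc (Suc k))"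
        using that by (simp add: lookup_expo nth_append)
      then show False
        using sym_superpolys_antisymmetric[OF f, of "Suc k" "length A" ?e] that lA ne by simp
    qed
    ultimately show ?thesis by simp
  qed
  then have "sorted_wrt (>) A"
    by (subst sorted_wrt_iff_nth_Suc_transp) (auto simp: transp_def)
  then have "(A, B) \<in> superpartitions N"
    using sorted lz by (simp add: superpartitions_def B_def ys_def A_def zs_def)
  moreover have "lead (A, B) f \<noteq> 0" using ne by (simp add: lead_def entries_def)
  ultimately show thesis by (rule that)
qed

section \<open>Triangular families\<close>

definition positive_parts :: "superpartition \<Rightarrow> nat" where
  "positive_parts \<Lambda> = length (filter (\<lambda>n. 0 < n) (snd \<Lambda>))"

definition triangular_family :: "nat \<Rightarrow> (superpartition \<Rightarrow> superpoly) \<Rightarrow> bool" where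
  "triangular_family N b \<longleftrightarrow> (\<forall>\<Lambda>\<in>superpartitions N.
     b \<Lambda> \<in> sym_superpolys N \<and> b \<Lambda> \<in> degrees_in {degree \<Lambda>} \<and> lead \<Lambda> (b \<Lambda>) \<noteq> 0 \<and>
     (\<forall>\<Omega>\<in>superpartitions N. lead \<Omega> (b \<Lambda>) \<noteq> 0 \<longrightarrow>
        \<Omega> = \<Lambda> \<or> positive_parts \<Omega> < positive_parts \<Lambda>))"

context
  fixes N b
  assumes b: "triangular_family N b"
begin

lemma triangular_family_independent:
  assumes "finite S" "S \<subseteq> superpartitions N" "(\<Sum>\<Lambda>\<in>S. scale (a \<Lambda>) (b \<Lambda>)) = 0" "\<Lambda> \<in> S"
  shows "a \<Lambda> = 0"
proof (rule ccontr)
  assume "a \<Lambda> \<noteq> 0"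
  let ?T = "{\<Lambda> \<in> S. a \<Lambda> \<noteq> 0}"
  have fT: "finite ?T" "?T \<noteq> {}" using assms(1,4) \<open>a \<Lambda> \<noteq> 0\<close> by (simp, blast)
  then have "Max (positive_parts ` ?T) \<in> positive_parts ` ?T" by (intro Max_in) auto
  then obtain \<Omega> where O: "\<Omega> \<in> ?T" "positive_parts \<Omega> = Max (positive_parts ` ?T)" by auto
  then have max: "positive_parts \<Gamma> \<le> positive_parts \<Omega>" if "\<Gamma> \<in> ?T" for \<Gamma>
    using that fT by simp
  have "a \<Gamma> * lead \<Omega> (b \<Gamma>) = 0" if "\<Gamma> \<in> S - {\<Omega>}" for \<Gamma>
  proof (rule ccontr)
    assume ne: "a \<Gamma> * lead \<Omega> (b \<Gamma>) \<noteq> 0"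
    then have "positive_parts \<Omega> < positive_parts \<Gamma>"
      using b that O(1) assms(2) unfolding triangular_family_def by auto
    moreover have "\<Gamma> \<in> ?T" using ne that by auto
    ultimately show False using max by fastforce
  qed
  then have "(\<Sum>\<Gamma>\<in>S - {\<Omega>}. a \<Gamma> * lead \<Omega> (b \<Gamma>)) = 0"
    by (intro sum.neutral ballI)
  then have "(\<Sum>\<Gamma>\<in>S. a \<Gamma> * lead \<Omega> (b \<Gamma>)) = a \<Omega> * lead \<Omega> (b \<Omega>)"
    using O(1) assms(1) by (simp add: sum.remove[of S \<Omega>])
  moreover have "(\<Sum>\<Gamma>\<in>S. a \<Gamma> * lead \<Omega> (b \<Gamma>)) = lead \<Omega> (\<Sum>\<Lambda>\<in>S. scale (a \<Lambda>) (b \<Lambda>))"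
    by (simp add: lead_sum lead_scale)
  ultimately have "a \<Omega> * lead \<Omega> (b \<Omega>) = 0" using assms(3) by simp
  then show False using O(1) assms(2) b unfolding triangular_family_def by auto
qed

lemma triangular_family_inj_on: "inj_on b (superpartitions N)"
proof (rule inj_onI, rule ccontr)
  fix x y assume xy: "x \<in> superpartitions N" "y \<in> superpartitions N" "b x = b y" "x \<noteq> y"
  have "x = y \<or> positive_parts x < positive_parts y" "y = x \<or> positive_parts y < positive_parts x"
    using b xy unfolding triangular_family_def by metis+
  then show False using xy(4) by auto
qed

lemma triangular_family_span:
  assumes "f \<in> sym_superpolys N" "f \<in> degrees_in D"
  shows "f \<in> superpoly.span (b ` {\<Lambda> \<in> superpartitions N. degree \<Lambda> \<in> D})" (is "_ \<in> ?W")
proof -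
  have *: "(\<forall>\<Lambda>\<in>superpartitions N. lead \<Lambda> f \<noteq> 0 \<longrightarrow> positive_parts \<Lambda> < n) \<Longrightarrow> f \<in> ?W" for n
    using assms
  proof (induction n arbitrary: f)
    case 0
    then have "f = 0" using sym_superpolys_lead by (metis not_less0)
    then show ?case by (simp add: superpoly.span_zero)
  next
    case (Suc n)
    define S where "S = {\<Lambda> \<in> superpartitions N. lead \<Lambda> f \<noteq> 0}"
    have S: "finite S" "S \<subseteq> superpartitions N" unfolding S_def by (auto simp: finite_lead)
    define c where "c \<Lambda> = lead \<Lambda> f / lead \<Lambda> (b \<Lambda>)" for \<Lambda>
    define h where "h = (\<Sum>\<Lambda>\<in>S. scale (c \<Lambda>) (b \<Lambda>))"
    have Sd: "degree \<Lambda> \<in> D" if "\<Lambda> \<in> S" for \<Lambda>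
      using that degree_lead[OF Suc.prems(3)] by (simp add: S_def)
    have hW: "h \<in> ?W"
      unfolding h_def
      by (intro superpoly.span_sum superpoly.span_scale superpoly.span_base) (use S Sd in auto)
    have hV: "h \<in> sym_superpolys N"
      unfolding h_def
      by (intro superpoly.subspace_sum superpoly.subspace_scale subspace_sym_superpolys)
        (use S b in \<open>auto simp: triangular_family_def\<close>)
    have hD: "h \<in> degrees_in D"
      unfolding h_def
    proof (intro superpoly.subspace_sum superpoly.subspace_scale subspace_degrees_in)
      fix \<Lambda> assume L: "\<Lambda> \<in> S"
      then have "b \<Lambda> \<in> degrees_in {degree \<Lambda>}" using b S by (auto simp: triangular_family_def)
      then show "b \<Lambda> \<in> degrees_in D" using degrees_in_mono[of "{degree \<Lambda>}" D] Sd[OF L] by auto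
    qed
    have "positive_parts \<Omega> < n" if O: "\<Omega> \<in> superpartitions N" "lead \<Omega> (f - h) \<noteq> 0" for \<Omega>
    proof (rule ccontr)
      assume n: "\<not> positive_parts \<Omega> < n"
      have "c \<Lambda> * lead \<Omega> (b \<Lambda>) = 0" if "\<Lambda> \<in> S" "\<Lambda> \<noteq> \<Omega>" for \<Lambda>
      proof (rule ccontr)
        assume "c \<Lambda> * lead \<Omega> (b \<Lambda>) \<noteq> 0"
        then have "positive_parts \<Omega> < positive_parts \<Lambda>"
          using b that S(2) O(1) unfolding triangular_family_def by auto
        moreover have "positive_parts \<Lambda> < Suc n" using Suc.prems(1) that(1) by (auto simp: S_def)
        ultimately show False using n by simp
      qed
      then have "lead \<Omega> h = (\<Sum>\<Lambda>\<in>S. if \<Lambda> = \<Omega> then c \<Omega> * lead \<Omega> (b \<Omega>) else 0)"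
        unfolding h_def lead_sum lead_scale by (intro sum.cong) auto
      also have "\<dots> = lead \<Omega> f"
        using S(1) O(1) b by (auto simp: S_def c_def triangular_family_def)
      finally show False using O(2) by (simp add: lead_diff)
    qed
    moreover have "f - h \<in> sym_superpolys N" "f - h \<in> degrees_in D"
      using hV hD Suc.prems superpoly.subspace_diff subspace_sym_superpolys subspace_degrees_in
      by blast+
    ultimately have "f - h \<in> ?W" using Suc.IH by blast
    then show ?case using superpoly.span_add[OF _ hW] by force
  qed
  have "positive_parts \<Lambda> < Suc N" if "\<Lambda> \<in> superpartitions N" for \<Lambda>
  proof -
    have "length (snd \<Lambda>) \<le> N" using that by (auto simp: superpartitions_def)
    then show ?thesis
      unfolding positive_parts_def less_Suc_eq_le by (rule le_trans[OF length_filter_le])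
  qed
  then show ?thesis by (intro *[of "Suc N"] ballI impI)
qed

lemma triangular_family_is_basis: "is_basis N b"
  unfolding is_basis_def
proof (intro conjI triangular_family_inj_on)
  show "superpoly.independent (b ` superpartitions N)"
    unfolding superpoly.independent_explicit_finite_subsets
  proof (intro allI impI ballI)
    fix T u v assume T: "T \<subseteq> b ` superpartitions N" "finite T" "(\<Sum>v\<in>T. scale (u v) v) = 0" "v \<in> T"
    then obtain S where S: "S \<subseteq> superpartitions N" "finite S" "T = b ` S"
      using finite_subset_image[OF T(2,1)] by blast
    then have "inj_on b S" using triangular_family_inj_on inj_on_subset by blast
    then have "(\<Sum>\<Lambda>\<in>S. scale (u (b \<Lambda>)) (b \<Lambda>)) = 0"
      using T(3) S(3) by (simp add: sum.reindex)
    then show "u v = 0"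
      using triangular_family_independent[OF S(2,1), of "\<lambda>\<Lambda>. u (b \<Lambda>)"] T(4) S(3) by auto
  qed
  show "superpoly.span (b ` superpartitions N) = sym_superpolys N"
  proof
    show "superpoly.span (b ` superpartitions N) \<subseteq> sym_superpolys N"
      by (rule superpoly.span_minimal[OF _ subspace_sym_superpolys])
        (use b in \<open>auto simp: triangular_family_def\<close>)
    have "f \<in> degrees_in UNIV" for f by (simp add: degrees_in_def x_graded_def)
    then show "sym_superpolys N \<subseteq> superpoly.span (b ` superpartitions N)"
      using triangular_family_span[of _ UNIV] by auto
  qed
qed

end

section \<open>Monomials and power sums are triangular\<close>

abbreviation super_term :: "(nat \<Rightarrow>\<^sub>0 nat) \<Rightarrow> nat list \<Rightarrow> superpoly" where
  "super_term e xs \<equiv> of_xpoly (Poly_Mapping.single e 1) * Theta xs"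

lemma lookup_mult_sign:
  "s \<in> {0, 1, - 1} \<Longrightarrow> Poly_Mapping.lookup (Poly_Mapping.single e (1::complex) * s) e' \<noteq> 0
    \<Longrightarrow> e = e' \<and> s \<noteq> 0"
  by (auto simp: lookup_single when_def split: if_splits)

lemma lead_super_term_neq_0:
  assumes "lead \<Omega> (super_term e xs) \<noteq> 0"
  shows "e = expo (entries \<Omega>)" "distinct xs" "set xs = {1..length (fst \<Omega>)}"
proof -
  let ?I = "firsts (length (fst \<Omega>))"
  have *: "e = expo (entries \<Omega>) \<and> coef (Theta xs) ?I \<noteq> 0"
    using lookup_mult_sign[OF coef_Theta_cases] assms[unfolded lead_def coef_of_xpoly_mult] by blast
  then show "e = expo (entries \<Omega>)" "distinct xs" using coef_Theta_neq_0 by blast+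
  from * have "?I = fset_of_list xs" using coef_Theta_neq_0 by blast
  then show "set xs = {1..length (fst \<Omega>)}" by (metis fset_firsts fset_of_list.rep_eq)
qed

lemma lead_super_term:
  "lead \<Lambda> (super_term (expo (entries \<Lambda>)) [1..<Suc (length (fst \<Lambda>))]) = 1"
proof -
  have "coef (Theta [1..<Suc (length (fst \<Lambda>))]) (firsts (length (fst \<Lambda>))) = 1"
    using coef_Theta_fset_list[of "firsts (length (fst \<Lambda>))"] by (simp add: fset_list_firsts del: upt_Suc fset_firsts)
  then show ?thesis unfolding lead_def coef_of_xpoly_mult by simp
qed

lemma lead_sum_super_terms:
  assumes "finite T"
    and "\<And>\<Omega> t. \<Omega> \<in> superpartitions N \<Longrightarrow> t \<in> T \<Longrightarrow> e t = expo (entries \<Omega>) \<Longrightarrow> distinct (xs t)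
      \<Longrightarrow> set (xs t) = {1..length (fst \<Omega>)}
      \<Longrightarrow> \<Omega> = \<Lambda> \<and> xs t = [1..<Suc (length (fst \<Lambda>))] \<or> positive_parts \<Omega> < positive_parts \<Lambda>"
    and "t0 \<in> T" "e t0 = expo (entries \<Lambda>)" "xs t0 = [1..<Suc (length (fst \<Lambda>))]"
    and "\<Lambda> \<in> superpartitions N"
  shows "lead \<Lambda> (\<Sum>t\<in>T. super_term (e t) (xs t)) \<noteq> 0"
    and "\<Omega> \<in> superpartitions N \<Longrightarrow> lead \<Omega> (\<Sum>t\<in>T. super_term (e t) (xs t)) \<noteq> 0
      \<Longrightarrow> \<Omega> = \<Lambda> \<or> positive_parts \<Omega> < positive_parts \<Lambda>"
proof -
  let ?L = "\<lambda>t. lead \<Lambda> (super_term (e t) (xs t))"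
  have "?L t = (if ?L t \<noteq> 0 then 1 else 0)" if t: "t \<in> T" for t
  proof (cases "?L t = 0")
    case False
    note l = lead_super_term_neq_0[OF False]
    have "xs t = [1..<Suc (length (fst \<Lambda>))]" using assms(2)[OF assms(6) t l] by simp
    then have "?L t = 1" using l(1) lead_super_term[of \<Lambda>] by (simp only:)
    then show ?thesis by (simp only:) simp
  qed simp
  then have "(\<Sum>t\<in>T. ?L t) = (\<Sum>t\<in>T. if ?L t \<noteq> 0 then 1 else 0)" by (rule sum.cong[OF refl])
  also have "\<dots> = of_nat (card {t \<in> T. ?L t \<noteq> 0})"
    using assms(1) by (simp add: sum.If_cases Int_def)
  also have "\<dots> \<noteq> 0"
  proof -
    have "?L t0 = 1" using assms(4,5) lead_super_term[of \<Lambda>] by (simp only:)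
    then have "t0 \<in> {t \<in> T. ?L t \<noteq> 0}" using assms(3) by simp
    then have "{t \<in> T. ?L t \<noteq> 0} \<noteq> {}" by blast
    moreover have "finite {t \<in> T. ?L t \<noteq> 0}" by (rule finite_subset[OF _ assms(1)]) blast
    ultimately have "card {t \<in> T. ?L t \<noteq> 0} \<noteq> 0" by (simp only: card_0_eq not_False_eq_True)
    then show ?thesis by (simp only: of_nat_eq_0_iff not_False_eq_True)
  qed
  finally show "lead \<Lambda> (\<Sum>t\<in>T. super_term (e t) (xs t)) \<noteq> 0" by (simp only: lead_sum not_False_eq_True)
next
  assume O: "\<Omega> \<in> superpartitions N" "lead \<Omega> (\<Sum>t\<in>T. super_term (e t) (xs t)) \<noteq> 0"
  then obtain t where t: "t \<in> T" "lead \<Omega> (super_term (e t) (xs t)) \<noteq> 0"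
    unfolding lead_sum by (metis (no_types, lifting) sum.neutral)
  then show "\<Omega> = \<Lambda> \<or> positive_parts \<Omega> < positive_parts \<Lambda>"
    using assms(2)[OF O(1) t(1) lead_super_term_neq_0[OF t(2)]] by blast
qed

lemma super_term_superpolys:
  assumes "Poly_Mapping.keys e \<subseteq> {1..N}" "set xs \<subseteq> {1..N}"
  shows "super_term e xs \<in> superpolys N"
  unfolding superpolys_iff
proof (intro allI impI conjI)
  fix I assume "coef (super_term e xs) I \<noteq> 0"
  then have "coef (Theta xs) I \<noteq> 0" by (auto simp: coef_of_xpoly_mult)
  then have "I = fset_of_list xs" using coef_Theta_neq_0 by blast
  then show "fset I \<subseteq> {1..N}" using assms(2) by (simp add: fset_of_list.rep_eq)
  show "coef (super_term e xs) I \<in> x_graded {1..N} UNIV"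
    using coef_Theta_cases[of xs I] assms(1) x_graded_single[of e "{1..N}" UNIV 1]
    by (auto simp: coef_of_xpoly_mult intro!: x_graded_uminus)
qed

lemma super_term_degrees_in:
  assumes "total e = d"
  shows "super_term e xs \<in> degrees_in {d}"
proof -
  have "coef (super_term e xs) I \<in> x_graded UNIV {d}" for I
    using coef_Theta_cases[of xs I] assms x_graded_single[of e UNIV "{d}" 1]
    by (auto simp: coef_of_xpoly_mult intro!: x_graded_uminus)
  then show ?thesis by (simp add: degrees_in_def)
qed

lemma sorted_desc_mset_eq:
  fixes xs ys :: "nat list"
  assumes "sorted_wrt (\<ge>) xs" "sorted_wrt (\<ge>) ys" "mset xs = mset ys"
  shows "xs = ys"
proof -
  have "sorted (rev xs)" "sorted (rev ys)" using assms by (simp_all add: sorted_wrt_rev)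
  moreover have "mset (rev xs) = mset (rev ys)" using assms(3) by simp
  ultimately have "rev xs = rev ys" by (metis properties_for_sort)
  then show ?thesis by simp
qed

lemma strict_desc_set_eq:
  fixes xs ys :: "nat list"
  assumes "sorted_wrt (>) xs" "sorted_wrt (>) ys" "set xs = set ys"
  shows "xs = ys"
proof -
  have "distinct xs" "distinct ys"
    using assms(1,2) by (auto simp: distinct_conv_nth sorted_wrt_iff_nth_less) (metis linorder_neqE_nat less_irrefl)+
  then have "mset xs = mset ys" using assms(3) by (metis set_eq_iff_mset_eq_distinct)
  moreover have "sorted_wrt (\<ge>) xs" "sorted_wrt (\<ge>) ys"
    using assms(1,2) by (auto elim: sorted_wrt_mono_rel[rotated])
  ultimately show ?thesis by (intro sorted_desc_mset_eq)
qed

lemma mset_eq_positive: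
  fixes M M' :: "nat multiset"
  assumes "filter_mset (\<lambda>n. 0 < n) M = filter_mset (\<lambda>n. 0 < n) M'" "size M = size M'"
  shows "M = M'"
proof (rule multiset_eqI)
  fix n
  have *: "size K = size (filter_mset (\<lambda>n. 0 < n) K) + count K 0" for K :: "nat multiset"
    by (induction K) auto
  show "count M n = count M' n"
  proof (cases "n = 0")
    case True
    then show ?thesis using *[of M] *[of M'] assms by simp
  next
    case False
    then show ?thesis using arg_cong[OF assms(1), of "\<lambda>K. count K n"] by simp
  qed
qed

lemma superpartitions_iff:
  "\<Lambda> \<in> superpartitions N \<longleftrightarrow> length (fst \<Lambda>) + length (snd \<Lambda>) = N
     \<and> sorted_wrt (>) (fst \<Lambda>) \<and> sorted_wrt (\<ge>) (snd \<Lambda>)"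
  by (auto simp: superpartitions_def)

lemma lookup_expo_fst:
  "k < length (fst \<Lambda>) \<Longrightarrow> Poly_Mapping.lookup (expo (entries \<Lambda>)) (Suc k) = fst \<Lambda> ! k"
  by (simp add: lookup_expo entries_def nth_append)

lemma snd_superpartition_expo:
  assumes "\<Lambda> \<in> superpartitions N"
  shows "snd \<Lambda> = map (Poly_Mapping.lookup (expo (entries \<Lambda>))) [Suc (length (fst \<Lambda>))..<Suc N]"
  by (rule nth_equalityI)
    (use assms in \<open>auto simp: superpartitions_iff lookup_expo entries_def nth_append simp del: upt_Suc\<close>)

lemma leading_term_unique:
  assumes L: "\<Lambda> \<in> superpartitions N" and O: "\<Omega> \<in> superpartitions N"
    and xs: "distinct xs" "set xs = {1..length (fst \<Omega>)}" "length xs = length (fst \<Lambda>)"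
    and A: "\<And>k. k < length xs \<Longrightarrow> Poly_Mapping.lookup (expo (entries \<Omega>)) (xs ! k) = fst \<Lambda> ! k"
    and B: "filter_mset (\<lambda>n. 0 < n) (mset (snd \<Omega>)) = filter_mset (\<lambda>n. 0 < n) (mset (snd \<Lambda>))"
  shows "\<Omega> = \<Lambda> \<and> xs = [1..<Suc (length (fst \<Lambda>))]"
proof -
  let ?m = "length (fst \<Lambda>)"
  have m: "length (fst \<Omega>) = ?m" using distinct_card[OF xs(1)] xs(2,3) by simp
  have mem: "xs ! k \<in> {1..?m}" if "k < ?m" for k
    using that nth_mem[of k xs] xs(2,3) m by auto
  have A': "fst \<Omega> ! (xs ! k - 1) = fst \<Lambda> ! k" if "k < ?m" for k
    using A[of k] lookup_expo_fst[of "xs ! k - 1" \<Omega>] mem[OF that] that xs(3) m by auto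
  have dist: "distinct (fst \<Omega>)" "distinct (fst \<Lambda>)"
    using L O unfolding superpartitions_iff
    by (auto simp: distinct_conv_nth sorted_wrt_iff_nth_less) (metis linorder_neqE_nat less_irrefl)+
  have "set (fst \<Lambda>) \<subseteq> set (fst \<Omega>)"
  proof
    fix x assume "x \<in> set (fst \<Lambda>)"
    then obtain k where k: "k < ?m" "x = fst \<Lambda> ! k" by (metis in_set_conv_nth)
    then have "xs ! k - 1 < length (fst \<Omega>)" using mem[OF k(1)] m by auto
    then show "x \<in> set (fst \<Omega>)" using A'[OF k(1)] k(2) by (metis nth_mem)
  qed
  then have "set (fst \<Lambda>) = set (fst \<Omega>)"
    by (rule card_subset_eq[OF finite_set]) (simp add: distinct_card dist m)
  then have fst: "fst \<Omega> = fst \<Lambda>"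
    using L O unfolding superpartitions_iff by (intro strict_desc_set_eq) auto
  have "mset (snd \<Omega>) = mset (snd \<Lambda>)"
    by (rule mset_eq_positive[OF B]) (use L O m in \<open>auto simp: superpartitions_iff\<close>)
  then have snd: "snd \<Omega> = snd \<Lambda>"
    using L O unfolding superpartitions_iff by (intro sorted_desc_mset_eq) auto
  have "xs = [1..<Suc ?m]"
  proof (rule nth_equalityI)
    fix k assume "k < length xs"
    then have k: "k < ?m" using xs(3) by simp
    then have "xs ! k - 1 = k"
      using A'[OF k] mem[OF k] dist(2) by (auto simp: fst nth_eq_iff_index_eq)
    then have "xs ! k = Suc k" using mem[OF k] by auto
    then show "xs ! k = [1..<Suc ?m] ! k" using k by (simp del: upt_Suc)
  qed (simp add: xs(3) del: upt_Suc)
  then show ?thesis using fst snd by (simp add: prod_eq_iff)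
qed

lemma super_monom_eq:
  "super_monom \<Lambda> = super_term (expo (entries \<Lambda>)) [1..<Suc (length (fst \<Lambda>))]"
  unfolding super_monom_def of_xpoly_commute Theta_def[symmetric]
  by (simp only: X_power prod_single_one finite_atLeastAtMost expo_def)

lemma super_perm_super_monom:
  "inj \<sigma> \<Longrightarrow> super_perm \<sigma> (super_monom \<Lambda>)
    = super_term (relabel \<sigma> (expo (entries \<Lambda>))) (map \<sigma> [1..<Suc (length (fst \<Lambda>))])"
  unfolding super_monom_eq by (simp only: super_perm_Theta x_subst_single)

lemma super_perm_sum_permutations:
  assumes "\<tau> permutes {1..N}"
  shows "super_perm \<tau> (\<Sum>\<sigma> | \<sigma> permutes {1..N}. super_perm \<sigma> f)
    = (\<Sum>\<sigma> | \<sigma> permutes {1..N}. super_perm \<sigma> f)"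
proof -
  have "super_perm \<tau> (\<Sum>\<sigma> | \<sigma> permutes {1..N}. super_perm \<sigma> f)
      = (\<Sum>\<sigma> | \<sigma> permutes {1..N}. super_perm (\<tau> \<circ> \<sigma>) f)"
    unfolding super_perm_sum
    by (rule sum.cong[OF refl], rule super_perm_super_perm) (use assms permutes_inj in auto)
  also have "\<dots> = (\<Sum>\<sigma> | \<sigma> permutes {1..N}. super_perm \<sigma> f)"
    by (rule setum_permutations_compose_left[OF assms, symmetric])
  finally show ?thesis .
qed

lemma triangular_family_scale:
  assumes "triangular_family N b" "\<And>\<Lambda>. c \<Lambda> \<noteq> 0"
  shows "triangular_family N (\<lambda>\<Lambda>. scale (c \<Lambda>) (b \<Lambda>))"
  using assms superpoly.subspace_scale[OF subspace_sym_superpolys]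
    superpoly.subspace_scale[OF subspace_degrees_in]
  by (auto simp: triangular_family_def lead_scale)

lemma triangular_family_m_super: "triangular_family N (m_super N)"
proof -
  have "triangular_family N (\<lambda>\<Lambda>. \<Sum>\<sigma> | \<sigma> permutes {1..N}. super_perm \<sigma> (super_monom \<Lambda>))"
    unfolding triangular_family_def
  proof (intro ballI conjI impI)
    fix \<Lambda> assume L: "\<Lambda> \<in> superpartitions N"
    let ?T = "{\<sigma>. \<sigma> permutes {1..N}}" and ?xs = "[1..<Suc (length (fst \<Lambda>))]"
    let ?f = "\<Sum>\<sigma>\<in>?T. super_perm \<sigma> (super_monom \<Lambda>)"
    let ?e = "\<lambda>\<sigma>. relabel \<sigma> (expo (entries \<Lambda>))"
    have fin: "finite ?T" by (simp add: finite_permutations)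
    have f: "?f = (\<Sum>\<sigma>\<in>?T. super_term (?e \<sigma>) (map \<sigma> ?xs))"
      by (rule sum.cong[OF refl], rule super_perm_super_monom) (use permutes_inj in auto)
    have lN: "length (entries \<Lambda>) = N" "length (fst \<Lambda>) \<le> N"
      using L by (auto simp: superpartitions_iff entries_def)
    have "super_term (?e \<sigma>) (map \<sigma> ?xs) \<in> superpolys N" if s: "\<sigma> permutes {1..N}" for \<sigma>
    proof (rule super_term_superpolys)
      have "Poly_Mapping.keys (?e \<sigma>) \<subseteq> \<sigma> ` {1..N}"
        using keys_relabel[of \<sigma> "expo (entries \<Lambda>)"] keys_expo[of "entries \<Lambda>"] lN(1) by blast
      then show "Poly_Mapping.keys (?e \<sigma>) \<subseteq> {1..N}" by (simp only: permutes_image[OF s])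
      have "\<sigma> ` set ?xs \<subseteq> \<sigma> ` {1..N}" using lN(2) by (intro image_mono) auto
      then show "set (map \<sigma> ?xs) \<subseteq> {1..N}" by (simp only: permutes_image[OF s] set_map)
    qed
    then have "?f \<in> superpolys N"
      unfolding f by (intro superpoly.subspace_sum subspace_superpolys) auto
    then show "?f \<in> sym_superpolys N"
      using super_perm_sum_permutations[OF permutes_swap_id] by (simp add: sym_superpolys_def)
    show "?f \<in> degrees_in {degree \<Lambda>}"
      unfolding f by (intro superpoly.subspace_sum subspace_degrees_in super_term_degrees_in)
        (simp add: total_relabel total_expo degree_def)
    have key: "\<Omega> = \<Lambda> \<and> map \<sigma> ?xs = ?xs \<or> positive_parts \<Omega> < positive_parts \<Lambda>"
      if O: "\<Omega> \<in> superpartitions N" and s: "\<sigma> \<in> ?T" and e: "?e \<sigma> = expo (entries \<Omega>)"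
        and d: "distinct (map \<sigma> ?xs)" and st: "set (map \<sigma> ?xs) = {1..length (fst \<Omega>)}" for \<Omega> \<sigma>
    proof (intro disjI1 leading_term_unique[OF L O d st])
      have s: "\<sigma> permutes {1..N}" using s by simp
      note inj = permutes_inj[OF s]
      have lk: "Poly_Mapping.lookup (expo (entries \<Omega>)) (\<sigma> k)
          = Poly_Mapping.lookup (expo (entries \<Lambda>)) k" for k
        unfolding e[symmetric] by (rule lookup_relabel[OF inj])
      show "length (map \<sigma> ?xs) = length (fst \<Lambda>)" by (simp del: upt_Suc)
      show "Poly_Mapping.lookup (expo (entries \<Omega>)) (map \<sigma> ?xs ! k) = fst \<Lambda> ! k"
        if "k < length (map \<sigma> ?xs)" for k
        using that by (simp add: lk lookup_expo_fst del: upt_Suc)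
      have m: "length (fst \<Omega>) = length (fst \<Lambda>)"
        using distinct_card[OF d] st by (simp del: upt_Suc)
      let ?ys = "[Suc (length (fst \<Lambda>))..<Suc N]"
      have ys: "set ?ys = {1..N} - set ?xs" by auto
      have "\<sigma> ` set ?ys = \<sigma> ` {1..N} - \<sigma> ` set ?xs"
        unfolding ys by (rule image_set_diff[OF inj])
      also have "\<dots> = {1..N} - {1..length (fst \<Lambda>)}"
        using st m by (simp only: permutes_image[OF s] set_map)
      also have "\<dots> = set ?ys" by auto
      finally have "set (map \<sigma> ?ys) = set ?ys" by (simp only: set_map)
      moreover have "distinct (map \<sigma> ?ys)"
        using inj by (auto simp: distinct_map intro: inj_on_subset)
      ultimately have "mset (map \<sigma> ?ys) = mset ?ys"
        by (metis set_eq_iff_mset_eq_distinct distinct_upt)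
      then have "mset (snd \<Omega>) = image_mset (Poly_Mapping.lookup (expo (entries \<Omega>))) (mset (map \<sigma> ?ys))"
        using snd_superpartition_expo[OF O] m by (metis mset_map)
      also have "\<dots> = mset (map (\<lambda>k. Poly_Mapping.lookup (expo (entries \<Omega>)) (\<sigma> k)) ?ys)"
        by (simp add: comp_def image_mset.compositionality)
      also have "\<dots> = mset (snd \<Lambda>)"
        unfolding lk using snd_superpartition_expo[OF L] by metis
      finally show "filter_mset (\<lambda>n. 0 < n) (mset (snd \<Omega>)) = filter_mset (\<lambda>n. 0 < n) (mset (snd \<Lambda>))"
        by simp
    qed
    have id: "id \<in> ?T" "?e id = expo (entries \<Lambda>)" "map id ?xs = ?xs"
      by (simp_all add: permutes_id relabel_def exponent_sum)
    show "lead \<Lambda> ?f \<noteq> 0"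
      unfolding f
      by (rule lead_sum_super_terms(1)[of ?T N ?e "\<lambda>\<sigma>. map \<sigma> ?xs", OF fin key id L])
    show "\<Omega> = \<Lambda> \<or> positive_parts \<Omega> < positive_parts \<Lambda>"
      if "\<Omega> \<in> superpartitions N" "lead \<Omega> ?f \<noteq> 0" for \<Omega>
      by (rule lead_sum_super_terms(2)[where T = ?T and e = ?e and xs = "\<lambda>\<sigma>. map \<sigma> ?xs" and N = N,
            OF fin key id L that[unfolded f]])
  qed
  moreover have "1 / complex_of_nat (m_norm \<Lambda>) \<noteq> 0" for \<Lambda>
    by (simp add: m_norm_def)
  ultimately show ?thesis
    using triangular_family_scale[of N _ "\<lambda>\<Lambda>. 1 / complex_of_nat (m_norm \<Lambda>)"]
    by (simp add: m_super_def[abs_def])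
qed

lemma prod_list_sum_distrib:
  fixes g :: "'a \<Rightarrow> 'b \<Rightarrow> 'c::ring_1"
  assumes "finite S"
  shows "prod_list (map (\<lambda>n. \<Sum>i\<in>S. g i n) ns)
    = (\<Sum>is | set is \<subseteq> S \<and> length is = length ns. prod_list (map2 g is ns))"
proof (induction ns)
  case Nil
  have "{is. set is \<subseteq> S \<and> length is = length []} = {[]}" by auto
  then show ?case by simp
next
  case (Cons n ns)
  let ?T = "{is. set is \<subseteq> S \<and> length is = length ns}"
  have img: "{is. set is \<subseteq> S \<and> length is = length (n # ns)} = (\<lambda>(i, is). i # is) ` (S \<times> ?T)"
    by (auto simp: length_Suc_conv image_iff)
  have "(\<Sum>is | set is \<subseteq> S \<and> length is = length (n # ns). prod_list (map2 g is (n # ns)))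
      = (\<Sum>(i, is)\<in>S \<times> ?T. g i n * prod_list (map2 g is ns))"
    unfolding img by (subst sum.reindex) (auto simp: inj_on_def intro!: sum.cong)
  also have "\<dots> = (\<Sum>i\<in>S. g i n) * (\<Sum>is\<in>?T. prod_list (map2 g is ns))"
    by (simp only: sum.cartesian_product[symmetric] sum_product)
  finally show ?case using Cons.IH by simp
qed

definition weight :: "nat list \<Rightarrow> nat list \<Rightarrow> nat \<Rightarrow>\<^sub>0 nat" where
  "weight is ns = sum_list (map2 Poly_Mapping.single is ns)"

lemma weight_simps [simp]:
  "weight [] ns = 0" "weight is [] = 0"
  "weight (i # is) (n # ns) = Poly_Mapping.single i n + weight is ns"
  by (simp_all add: weight_def)

lemma total_weight: "length is = length ns \<Longrightarrow> total (weight is ns) = sum_list ns"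
  by (induction "is" ns rule: list_induct2) auto

lemma lookup_weight_notin: "j \<notin> set is \<Longrightarrow> Poly_Mapping.lookup (weight is ns) j = 0"
proof (induction "is" arbitrary: ns)
  case (Cons i "is")
  then show ?case by (cases ns) (auto simp: lookup_add lookup_single)
qed simp

lemma keys_weight: "Poly_Mapping.keys (weight is ns) \<subseteq> set is"
  using lookup_weight_notin by (auto simp: in_keys_iff)

lemma lookup_weight_nth:
  "length is = length ns \<Longrightarrow> distinct is \<Longrightarrow> k < length is
    \<Longrightarrow> Poly_Mapping.lookup (weight is ns) (is ! k) = ns ! k"
proof (induction "is" ns arbitrary: k rule: list_induct2)
  case (Cons i "is" n ns)
  show ?case
  proof (cases k)
    case 0
    then show ?thesis using Cons.prems by (simp add: lookup_add lookup_weight_notin)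
  next
    case (Suc k')
    then have "is ! k' \<noteq> i" using Cons.prems by (auto simp: in_set_conv_nth)
    then show ?thesis using Cons Suc by (simp add: lookup_add lookup_single when_def)
  qed
qed simp

lemma prod_list_boson:
  "length js = length ns \<Longrightarrow>
    prod_list (map2 (\<lambda>i n. of_xpoly (X i ^ n)) js ns) = of_xpoly (Poly_Mapping.single (weight js ns) 1)"
proof (induction js ns rule: list_induct2)
  case (Cons j js n ns)
  then show ?case by (simp add: X_power mult_single flip: of_xpoly_mult)
qed simp

lemma prod_list_fermion:
  "length is = length ns \<Longrightarrow>
    prod_list (map2 (\<lambda>i n. theta i * of_xpoly (X i ^ n)) is ns) = super_term (weight is ns) is"
proof (induction "is" ns rule: list_induct2)
  case (Cons i "is" n ns)
  have "theta i * of_xpoly (X i ^ n) * super_term (weight is ns) is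
      = super_term (Poly_Mapping.single i n) [i] * super_term (weight is ns) is"
    by (simp add: of_xpoly_commute X_power Theta_Cons)
  also have "\<dots> = super_term (weight (i # is) (n # ns)) (i # is)"
    unfolding Theta_term_mult by (simp add: mult_single)
  finally show ?case using Cons.IH by simp
qed simp

abbreviation positives :: "nat list \<Rightarrow> nat list" where
  "positives B \<equiv> filter (\<lambda>n. 0 < n) B"

definition choices :: "nat \<Rightarrow> superpartition \<Rightarrow> (nat list \<times> nat list) set" where
  "choices N \<Lambda> = {is. set is \<subseteq> {1..N} \<and> length is = length (fst \<Lambda>)} \<times>
     {js. set js \<subseteq> {1..N} \<and> length js = length (positives (snd \<Lambda>))}"

lemma finite_choices: "finite (choices N \<Lambda>)"
  by (simp add: choices_def finite_lists_length_eq)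

abbreviation choice_weight :: "superpartition \<Rightarrow> nat list \<times> nat list \<Rightarrow> nat \<Rightarrow>\<^sub>0 nat" where
  "choice_weight \<Lambda> t \<equiv> weight (fst t) (fst \<Lambda>) + weight (snd t) (positives (snd \<Lambda>))"

lemma p_super_expand:
  "p_super N \<Lambda> = (\<Sum>t\<in>choices N \<Lambda>. super_term (choice_weight \<Lambda> t) (fst t))"
proof -
  let ?A = "fst \<Lambda>" and ?B = "positives (snd \<Lambda>)"
  let ?TA = "{is. set is \<subseteq> {1..N} \<and> length is = length ?A}"
  let ?TB = "{js. set js \<subseteq> {1..N} \<and> length js = length ?B}"
  have pos: "prod_list (map (power_sum N) B) = prod_list (map (power_sum N) (positives B))" for B
    by (induction B) (auto simp: power_sum_def)
  have "prod_list (map (power_sum N) (snd \<Lambda>)) = prod_list (map (power_sum N) ?B)"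
    by (rule pos)
  also have "map (power_sum N) ?B = map (\<lambda>n. \<Sum>i\<in>{1..N}. of_xpoly (X i ^ n)) ?B"
    by (rule map_cong) (auto simp: power_sum_def of_xpoly_sum)
  also have "prod_list \<dots> = (\<Sum>js\<in>?TB. of_xpoly (Poly_Mapping.single (weight js ?B) 1))"
    by (subst prod_list_sum_distrib) (auto intro!: sum.cong prod_list_boson)
  finally have B: "prod_list (map (power_sum N) (snd \<Lambda>))
      = (\<Sum>js\<in>?TB. of_xpoly (Poly_Mapping.single (weight js ?B) 1))" .
  have "map (fermionic_power_sum N) ?A = map (\<lambda>n. \<Sum>i\<in>{1..N}. theta i * of_xpoly (X i ^ n)) ?A"
    by (rule map_cong) (auto simp: fermionic_power_sum_def)
  then have A: "prod_list (map (fermionic_power_sum N) ?A) = (\<Sum>is\<in>?TA. super_term (weight is ?A) is)"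
    by (simp only:, subst prod_list_sum_distrib) (auto intro!: sum.cong prod_list_fermion)
  have "super_term e xs * of_xpoly (Poly_Mapping.single e' 1) = super_term (e + e') xs" for e e' xs
    using Theta_term_mult[of _ xs _ "[]"] by (simp add: mult_single)
  then show ?thesis
    unfolding p_super_def A B choices_def sum_product
    by (simp add: sum.cartesian_product case_prod_beta)
qed

lemma super_perm_power_sum:
  assumes "\<sigma> permutes {1..N}"
  shows "super_perm \<sigma> (power_sum N n) = power_sum N n"
proof -
  have "x_subst \<sigma> (\<Sum>i\<in>{1..N}. X i ^ n) = (\<Sum>i\<in>{1..N}. X (\<sigma> i) ^ n)"
    unfolding x_subst_sum by (simp add: X_power x_subst_single)
  also have "\<dots> = (\<Sum>i\<in>{1..N}. X i ^ n)"
    by (rule sum.reindex_bij_betw[OF permutes_imp_bij[OF assms]])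
  finally show ?thesis by (simp add: power_sum_def super_perm_of_xpoly)
qed

lemma super_perm_fermionic_power_sum:
  assumes "\<sigma> permutes {1..N}"
  shows "super_perm \<sigma> (fermionic_power_sum N n) = fermionic_power_sum N n"
proof -
  have "super_perm \<sigma> (\<Sum>i\<in>{1..N}. theta i * of_xpoly (X i ^ n))
      = (\<Sum>i\<in>{1..N}. theta (\<sigma> i) * of_xpoly (X (\<sigma> i) ^ n))"
    unfolding super_perm_sum
    by (simp add: super_perm_mult[OF permutes_inj[OF assms]] super_perm_theta super_perm_of_xpoly
        X_power x_subst_single)
  also have "\<dots> = (\<Sum>i\<in>{1..N}. theta i * of_xpoly (X i ^ n))"
    by (rule sum.reindex_bij_betw[OF permutes_imp_bij[OF assms]])
  finally show ?thesis by (simp add: fermionic_power_sum_def)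
qed

lemma super_perm_p_super:
  assumes "\<sigma> permutes {1..N}"
  shows "super_perm \<sigma> (p_super N \<Lambda>) = p_super N \<Lambda>"
  by (simp add: p_super_def super_perm_mult super_perm_prod_list permutes_inj[OF assms] comp_def
      super_perm_power_sum[OF assms] super_perm_fermionic_power_sum[OF assms])

lemma sum_list_positives: "sum_list (positives B) = sum_list B"
  by (induction B) auto

lemma positives_append:
  "sorted_wrt (\<ge>) B \<Longrightarrow> B = positives B @ replicate (length B - length (positives B)) 0"
proof (induction B)
  case (Cons x B)
  show ?case
  proof (cases "x = 0")
    case True
    then have "positives B = []" using Cons.prems by (auto simp: filter_empty_conv)
    moreover from this have "B = replicate (length B) 0" using Cons by simp
    ultimately show ?thesis using True by simp
  qed (use Cons in simp)
qed simp

lemma choice_leading: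
  assumes L: "\<Lambda> \<in> superpartitions N" and O: "\<Omega> \<in> superpartitions N" and t: "t \<in> choices N \<Lambda>"
    and e: "choice_weight \<Lambda> t = expo (entries \<Omega>)"
    and d: "distinct (fst t)" and st: "set (fst t) = {1..length (fst \<Omega>)}"
  shows "\<Omega> = \<Lambda> \<and> fst t = [1..<Suc (length (fst \<Lambda>))] \<or> positive_parts \<Omega> < positive_parts \<Lambda>"
proof (cases "positive_parts \<Omega> < positive_parts \<Lambda>")
  case False
  let ?E = "Poly_Mapping.lookup (expo (entries \<Omega>))" and ?m = "length (fst \<Omega>)"
  let ?B = "positives (snd \<Lambda>)"
  define xs js where "xs = fst t" and "js = snd t"
  have l: "length xs = length (fst \<Lambda>)" "length js = length ?B"
    using t by (auto simp: choices_def xs_def js_def)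
  have E: "?E i = Poly_Mapping.lookup (weight xs (fst \<Lambda>)) i + Poly_Mapping.lookup (weight js ?B) i" for i
    using e by (simp flip: e add: lookup_add xs_def js_def)
  define qs where "qs = filter (\<lambda>i. 0 < ?E i) [Suc ?m..<Suc N]"
  have qs: "positives (snd \<Omega>) = map ?E qs"
    by (subst snd_superpartition_expo[OF O]) (simp only: filter_map comp_def qs_def)
  have dq: "distinct qs" by (simp add: qs_def)
  have sub: "set qs \<subseteq> set js"
  proof
    fix i assume "i \<in> set qs"
    then have i: "?m < i" "0 < ?E i" by (auto simp: qs_def)
    then have "i \<notin> set xs" using st by (auto simp: xs_def)
    then have "0 < Poly_Mapping.lookup (weight js ?B) i"
      using i(2) by (simp add: E lookup_weight_notin)
    then show "i \<in> set js" using lookup_weight_notin by (metis less_irrefl)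
  qed
  have "card (set qs) \<le> card (set js)" by (rule card_mono[OF finite_set sub])
  moreover have "card (set js) \<le> length js" by (rule card_length)
  moreover have "length js \<le> card (set qs)"
  proof -
    have "length js = positive_parts \<Lambda>" by (simp add: positive_parts_def l)
    moreover have "card (set qs) = positive_parts \<Omega>"
      unfolding positive_parts_def qs by (simp add: distinct_card[OF dq])
    ultimately show ?thesis using False by simp
  qed
  ultimately have c: "card (set qs) = card (set js)" "card (set js) = length js" by linarith+
  have eq: "set qs = set js" by (rule card_subset_eq[OF finite_set sub c(1)])
  have dj: "distinct js" using c(2) by (rule card_distinct)
  have dis: "i \<notin> set xs" if "i \<in> set js" for i
    using that st unfolding eq[symmetric] by (auto simp: qs_def xs_def)
  have "map ?E js = ?B"
  proof (rule nth_equalityI)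
    fix k assume "k < length (map ?E js)"
    then have k: "k < length js" by simp
    then have "js ! k \<notin> set xs" using dis nth_mem by blast
    then show "map ?E js ! k = ?B ! k"
      using lookup_weight_nth[OF l(2) dj k] k by (simp add: E lookup_weight_notin)
  qed (simp add: l)
  moreover have "mset qs = mset js" using eq dq dj by (simp add: set_eq_iff_mset_eq_distinct)
  ultimately have "mset (positives (snd \<Omega>)) = mset ?B" unfolding qs by (metis mset_map)
  then have B: "filter_mset (\<lambda>n. 0 < n) (mset (snd \<Omega>)) = filter_mset (\<lambda>n. 0 < n) (mset (snd \<Lambda>))"
    by (simp only: mset_filter)
  have "?E (xs ! k) = fst \<Lambda> ! k" if k: "k < length xs" for k
  proof -
    have "xs ! k \<notin> set js" using dis nth_mem[OF k] by blast
    then show ?thesis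
      using lookup_weight_nth[OF l(1) d[folded xs_def] k] by (simp add: E lookup_weight_notin)
  qed
  then show ?thesis
    using leading_term_unique[OF L O d st l(1)[unfolded xs_def] _ B] by (simp add: xs_def)
qed simp

lemma choice_leading_exists:
  assumes L: "\<Lambda> \<in> superpartitions N"
  obtains t where "t \<in> choices N \<Lambda>" "choice_weight \<Lambda> t = expo (entries \<Lambda>)"
    "fst t = [1..<Suc (length (fst \<Lambda>))]"
proof -
  let ?m = "length (fst \<Lambda>)" and ?B = "positives (snd \<Lambda>)"
  let ?xs = "[1..<Suc ?m]" and ?js = "[Suc ?m..<Suc ?m + length ?B]"
  have lN: "?m + length (snd \<Lambda>) = N" "sorted_wrt (\<ge>) (snd \<Lambda>)"
    using L by (auto simp: superpartitions_iff)
  have lB: "length ?B \<le> length (snd \<Lambda>)" by (rule length_filter_le)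
  have js: "set ?js \<subseteq> {1..N}"
  proof
    fix x assume "x \<in> set ?js"
    then have "Suc ?m \<le> x" "x < Suc ?m + length ?B" by (simp_all only: set_upt atLeastLessThan_iff)
    then show "x \<in> {1..N}" using lN(1) lB unfolding atLeastAtMost_iff by linarith
  qed
  then have c: "(?xs, ?js) \<in> choices N \<Lambda>"
    using lN(1) by (auto simp: choices_def simp del: upt_Suc)
  have "Poly_Mapping.lookup (weight ?xs (fst \<Lambda>) + weight ?js ?B) i
      = Poly_Mapping.lookup (expo (entries \<Lambda>)) i" for i
  proof -
    consider "i = 0 \<or> N < i" | k where "k < ?m" "i = Suc k"
      | k where "k < length ?B" "i = Suc (?m + k)" | k where "length ?B \<le> k" "k < length (snd \<Lambda>)" "i = Suc (?m + k)"
    proof -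
      have "i = 0 \<or> N < i \<or> (\<exists>k<?m. i = Suc k) \<or> (\<exists>k. k < length (snd \<Lambda>) \<and> i = Suc (?m + k))"
        using lN(1) by presburger
      then show thesis using that by (metis linorder_le_less_linear)
    qed
    then show ?thesis
    proof cases
      case 1
      then have "i \<notin> {1..N}" by auto
      moreover have "set ?xs \<subseteq> {1..N}" using lN(1) by auto
      ultimately have "i \<notin> set ?xs" "i \<notin> set ?js" using js by blast+
      moreover have "Poly_Mapping.lookup (expo (entries \<Lambda>)) i = 0"
        using 1 lN(1) by (auto simp: lookup_expo entries_def)
      ultimately show ?thesis by (simp add: lookup_add lookup_weight_notin del: upt_Suc)
    next
      case (2 k)
      then have "Poly_Mapping.lookup (weight ?xs (fst \<Lambda>)) (?xs ! k) = fst \<Lambda> ! k"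
        by (intro lookup_weight_nth) auto
      moreover have "?xs ! k = i" using 2 by (simp del: upt_Suc)
      moreover have "i \<notin> set ?js" using 2 by auto
      ultimately show ?thesis
        using 2 by (simp add: lookup_add lookup_weight_notin lookup_expo_fst del: upt_Suc)
    next
      case (3 k)
      then have "Poly_Mapping.lookup (weight ?js ?B) (?js ! k) = ?B ! k"
        by (intro lookup_weight_nth) auto
      moreover have "?js ! k = i" using 3 by (simp del: upt_Suc)
      moreover have "i \<notin> set ?xs" using 3 by auto
      moreover have "snd \<Lambda> ! k = ?B ! k"
        by (subst positives_append[OF lN(2)]) (simp add: nth_append 3)
      moreover have "k < length (snd \<Lambda>)" using 3(1) lB by (rule less_le_trans)
      ultimately show ?thesis
        using 3 by (simp add: lookup_add lookup_weight_notin lookup_expo entries_def nth_append del: upt_Suc)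
    next
      case (4 k)
      have "i \<notin> set ?xs" "i \<notin> set ?js" using 4 by auto
      moreover have "snd \<Lambda> ! k = 0"
        by (subst positives_append[OF lN(2)]) (use 4 in \<open>simp add: nth_append\<close>)
      ultimately show ?thesis
        using 4 by (simp add: lookup_add lookup_weight_notin lookup_expo entries_def nth_append del: upt_Suc)
    qed
  qed
  then have "choice_weight \<Lambda> (?xs, ?js) = expo (entries \<Lambda>)"
    by (intro poly_mapping_eqI) (simp only: fst_conv snd_conv)
  with c show thesis using that by (metis fst_conv)
qed

lemma triangular_family_p_super: "triangular_family N (p_super N)"
  unfolding triangular_family_def
proof (intro ballI conjI impI)
  fix \<Lambda> assume L: "\<Lambda> \<in> superpartitions N"
  have "super_term (choice_weight \<Lambda> t) (fst t) \<in> superpolys N" if t: "t \<in> choices N \<Lambda>" for t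
  proof (rule super_term_superpolys)
    have s: "set (fst t) \<subseteq> {1..N}" "set (snd t) \<subseteq> {1..N}" using t by (auto simp: choices_def)
    have "Poly_Mapping.keys (choice_weight \<Lambda> t) \<subseteq> set (fst t) \<union> set (snd t)"
      using keys_add[of "weight (fst t) (fst \<Lambda>)" "weight (snd t) (positives (snd \<Lambda>))"]
        keys_weight[of "fst t" "fst \<Lambda>"] keys_weight[of "snd t" "positives (snd \<Lambda>)"] by blast
    then show "Poly_Mapping.keys (choice_weight \<Lambda> t) \<subseteq> {1..N}" using s by blast
    show "set (fst t) \<subseteq> {1..N}" by (rule s(1))
  qed
  then have "p_super N \<Lambda> \<in> superpolys N"
    unfolding p_super_expand by (intro superpoly.subspace_sum subspace_superpolys)
  then show "p_super N \<Lambda> \<in> sym_superpolys N"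
    by (simp add: sym_superpolys_def super_perm_p_super permutes_swap_id)
  show "p_super N \<Lambda> \<in> degrees_in {degree \<Lambda>}"
    unfolding p_super_expand
  proof (intro superpoly.subspace_sum subspace_degrees_in super_term_degrees_in)
    fix t assume "t \<in> choices N \<Lambda>"
    then have "length (fst t) = length (fst \<Lambda>)" "length (snd t) = length (positives (snd \<Lambda>))"
      by (auto simp: choices_def)
    then show "total (choice_weight \<Lambda> t) = degree \<Lambda>"
      by (simp add: total_weight sum_list_positives degree_def entries_def)
  qed
  obtain t0 where t0: "t0 \<in> choices N \<Lambda>" "choice_weight \<Lambda> t0 = expo (entries \<Lambda>)"
      "fst t0 = [1..<Suc (length (fst \<Lambda>))]"
    by (rule choice_leading_exists[OF L])
  have key: "\<Omega> = \<Lambda> \<and> fst t = [1..<Suc (length (fst \<Lambda>))] \<or> positive_parts \<Omega> < positive_parts \<Lambda>"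
    if "\<Omega> \<in> superpartitions N" "t \<in> choices N \<Lambda>" "choice_weight \<Lambda> t = expo (entries \<Omega>)"
      "distinct (fst t)" "set (fst t) = {1..length (fst \<Omega>)}" for \<Omega> t
    using choice_leading[OF L that] .
  show "lead \<Lambda> (p_super N \<Lambda>) \<noteq> 0"
    unfolding p_super_expand
    by (rule lead_sum_super_terms(1)[where T = "choices N \<Lambda>" and e = "choice_weight \<Lambda>"
          and xs = fst and N = N, OF finite_choices key t0 L])
  show "\<Omega> = \<Lambda> \<or> positive_parts \<Omega> < positive_parts \<Lambda>"
    if "\<Omega> \<in> superpartitions N" "lead \<Omega> (p_super N \<Lambda>) \<noteq> 0" for \<Omega>
    by (rule lead_sum_super_terms(2)[where T = "choices N \<Lambda>" and e = "choice_weight \<Lambda>"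
          and xs = fst and N = N, OF finite_choices key t0 L that[unfolded p_super_expand]])
qed

section \<open>The deformed bases\<close>

context
  fixes N \<beta> :: nat and \<omega> :: real
begin

abbreviation Ep :: "superpoly \<Rightarrow> superpoly" where
  "Ep \<equiv> exp_Laplacian N \<beta> (1 / (4 * \<omega>))"

abbreviation Em :: "superpoly \<Rightarrow> superpoly" where
  "Em \<equiv> exp_Laplacian N \<beta> (- 1 / (4 * \<omega>))"

lemma linear_exp_Laplacian: "linear_op (exp_Laplacian N \<beta> t)"
  unfolding exp_Laplacian_def by (rule linear_exp_op[OF linear_Laplacian Laplacian_nilpotent])

lemma Em_Ep: "Em (Ep f) = f" and Ep_Em: "Ep (Em f) = f"
  using exp_op_cancel[OF linear_Laplacian[of N \<beta>] Laplacian_nilpotent, of "complex_of_real (1 / (4 * \<omega>))" f]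
    exp_op_cancel[OF linear_Laplacian[of N \<beta>] Laplacian_nilpotent, of "complex_of_real (- 1 / (4 * \<omega>))" f]
  by (simp_all add: exp_Laplacian_def)

lemma exp_Laplacian_sym_superpolys:
  "f \<in> sym_superpolys N \<Longrightarrow> exp_Laplacian N \<beta> t f \<in> sym_superpolys N"
  unfolding exp_Laplacian_def
  by (rule exp_op_mem[OF linear_Laplacian Laplacian_nilpotent subspace_sym_superpolys])
    (auto intro: Laplacian_sym_superpolys)

lemma exp_Laplacian_minus_id:
  assumes "f \<in> degrees_in {d}"
  shows "exp_Laplacian N \<beta> t f - f \<in> degrees_in {d'. \<exists>n\<ge>1. d' + 2 * n = d}"
  unfolding exp_Laplacian_def
proof (rule exp_op_minus_id_mem[OF linear_Laplacian Laplacian_nilpotent subspace_degrees_in])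
  fix n :: nat assume "1 \<le> n"
  then have "{d'. d' + 2 * n \<in> {d}} \<subseteq> {d'. \<exists>n\<ge>1. d' + 2 * n = d}" by auto
  then show "(Laplacian N \<beta> ^^ n) f \<in> degrees_in {d'. \<exists>n\<ge>1. d' + 2 * n = d}"
    using Laplacian_funpow_degrees_in[OF assms] degrees_in_mono by blast
qed

lemma exp_Laplacian_degrees_below:
  assumes "f \<in> degrees_in {..<d}"
  shows "exp_Laplacian N \<beta> t f \<in> degrees_in {..<d}"
  unfolding exp_Laplacian_def
proof (rule exp_op_mem[OF linear_Laplacian Laplacian_nilpotent subspace_degrees_in _ assms])
  fix g assume "g \<in> degrees_in {..<d}"
  then have "Laplacian N \<beta> g \<in> degrees_in {d'. d' + 2 \<in> {..<d}}" by (rule Laplacian_degrees_in)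
  moreover have "{d'. d' + 2 \<in> {..<d}} \<subseteq> {..<d}" by auto
  ultimately show "Laplacian N \<beta> g \<in> degrees_in {..<d}" using degrees_in_mono by blast
qed

lemma u_less_iff: "\<Omega> <\<^sub>u \<Lambda> \<longleftrightarrow> (\<exists>n\<ge>1. degree \<Omega> + 2 * n = degree \<Lambda>)"
proof -
  have "(int (degree \<Omega>) = int (degree \<Lambda>) - 2 * int n) \<longleftrightarrow> degree \<Omega> + 2 * n = degree \<Lambda>" for n
    by linarith
  then show ?thesis by (auto simp: u_less_def u_le_def)
qed

lemma finite_superpartitions_degree: "finite {\<Omega> \<in> superpartitions N. degree \<Omega> < d}"
proof -
  have "{\<Omega> \<in> superpartitions N. degree \<Omega> < d}
      \<subseteq> (\<Union>m\<le>N. {xs. set xs \<subseteq> {..<d} \<and> length xs = m}) \<times> (\<Union>m\<le>N. {xs. set xs \<subseteq> {..<d} \<and> length xs = m})"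
  proof
    fix \<Omega> assume O: "\<Omega> \<in> {\<Omega> \<in> superpartitions N. degree \<Omega> < d}"
    have "x < d" if "x \<in> set (entries \<Omega>)" for x
      using member_le_sum_list[OF that] O by (simp add: degree_def)
    then show "\<Omega> \<in> (\<Union>m\<le>N. {xs. set xs \<subseteq> {..<d} \<and> length xs = m}) \<times> (\<Union>m\<le>N. {xs. set xs \<subseteq> {..<d} \<and> length xs = m})"
      using O by (auto simp: superpartitions_def entries_def)
  qed
  then show ?thesis
    by (rule finite_subset) (intro finite_cartesian_product finite_UN_I finite_lists_length_eq finite_atMost finite_lessThan)
qed

lemma finite_u_less: "finite {\<Omega>. \<Omega> \<in> superpartitions N \<and> \<Omega> <\<^sub>u \<Lambda>}"
  by (rule finite_subset[OF _ finite_superpartitions_degree[of "degree \<Lambda>"]]) (auto simp: u_less_iff)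

context
  fixes e :: "superpartition \<Rightarrow> superpoly"
  assumes e: "triangular_family N e"
begin

lemma e_props:
  assumes "\<Lambda> \<in> superpartitions N"
  shows "e \<Lambda> \<in> sym_superpolys N" "e \<Lambda> \<in> superpolys N" "e \<Lambda> \<in> degrees_in {degree \<Lambda>}"
  using e assms by (auto simp: triangular_family_def sym_superpolys_def)

lemma is_basis_Em: "is_basis N (\<lambda>\<Lambda>. Em (e \<Lambda>))"
proof -
  have b: "is_basis N e" by (rule triangular_family_is_basis[OF e])
  have inj: "inj Em" by (metis Ep_Em injI)
  have im: "(\<lambda>\<Lambda>. Em (e \<Lambda>)) ` superpartitions N = Em ` e ` superpartitions N" by auto
  have "inj_on (\<lambda>\<Lambda>. Em (e \<Lambda>)) (superpartitions N)"
    using b inj unfolding is_basis_def by (auto simp: inj_on_def)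
  moreover have "superpoly.independent (Em ` e ` superpartitions N)"
    using b superpoly.linear_independent_injective_image[OF linear_exp_Laplacian]
      inj_on_subset[OF inj] unfolding is_basis_def by blast
  moreover have "superpoly.span (Em ` e ` superpartitions N) = sym_superpolys N"
  proof -
    have "superpoly.span (Em ` e ` superpartitions N) = Em ` superpoly.span (e ` superpartitions N)"
      by (rule superpoly.linear_span_image[OF linear_exp_Laplacian])
    also have "\<dots> = Em ` sym_superpolys N" using b by (simp add: is_basis_def)
    also have "\<dots> = sym_superpolys N"
    proof
      show "Em ` sym_superpolys N \<subseteq> sym_superpolys N" using exp_Laplacian_sym_superpolys by blast
      show "sym_superpolys N \<subseteq> Em ` sym_superpolys N"
        using exp_Laplacian_sym_superpolys Em_Ep by (metis image_eqI subsetI)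
    qed
    finally show ?thesis .
  qed
  ultimately show ?thesis unfolding is_basis_def im by blast
qed

lemma H1_eigen_Em: "H1_eigen N \<beta> \<omega> (\<lambda>\<Lambda>. Em (e \<Lambda>))"
  unfolding H1_eigen_def H1_def Ep_Em
proof
  fix \<Lambda> assume "\<Lambda> \<in> superpartitions N"
  then have "coefwise (x_euler N) (e \<Lambda>) = scale (of_nat (degree \<Lambda>)) (e \<Lambda>)"
    using e_props by (intro x_euler_degrees_in)
  then show "Em (coefwise (x_euler N) (e \<Lambda>)) = scale (of_nat (degree \<Lambda>)) (Em (e \<Lambda>))"
    by (simp only: superpoly.linear_scale[OF linear_exp_Laplacian])
qed

lemma u_triangular_Em: "u_triangular N e (\<lambda>\<Lambda>. Em (e \<Lambda>))"
proof -
  have "\<exists>y. Em (e \<Lambda>) = e \<Lambda> + (\<Sum>\<Omega> | \<Omega> \<in> superpartitions N \<and> \<Omega> <\<^sub>u \<Lambda>. scale (y \<Omega>) (e \<Omega>))"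
    if L: "\<Lambda> \<in> superpartitions N" for \<Lambda>
  proof -
    let ?S = "{\<Omega>. \<Omega> \<in> superpartitions N \<and> \<Omega> <\<^sub>u \<Lambda>}"
    have "Em (e \<Lambda>) - e \<Lambda> \<in> sym_superpolys N"
      by (intro superpoly.subspace_diff subspace_sym_superpolys exp_Laplacian_sym_superpolys e_props L)
    then have "Em (e \<Lambda>) - e \<Lambda>
        \<in> superpoly.span (e ` {\<Omega> \<in> superpartitions N. degree \<Omega> \<in> {d'. \<exists>n\<ge>1. d' + 2 * n = degree \<Lambda>}})"
      by (rule triangular_family_span[OF e _ exp_Laplacian_minus_id[OF e_props(3)[OF L]]])
    then have "Em (e \<Lambda>) - e \<Lambda> \<in> superpoly.span (e ` ?S)" by (simp add: u_less_iff)
    then obtain u where u: "Em (e \<Lambda>) - e \<Lambda> = (\<Sum>v\<in>e ` ?S. scale (u v) v)"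
      using superpoly.span_finite[OF finite_imageI[OF finite_u_less, of e \<Lambda>]] by auto
    have "inj_on e ?S"
      by (rule inj_on_subset[OF triangular_family_inj_on[OF e]]) auto
    then have "Em (e \<Lambda>) - e \<Lambda> = (\<Sum>\<Omega>\<in>?S. scale (u (e \<Omega>)) (e \<Omega>))"
      unfolding u by (simp add: sum.reindex)
    then have "Em (e \<Lambda>) = e \<Lambda> + (\<Sum>\<Omega>\<in>?S. scale (u (e \<Omega>)) (e \<Omega>))"
      by (simp only: diff_eq_eq add.commute)
    then show ?thesis by (rule exI[of _ "\<lambda>\<Omega>. u (e \<Omega>)"])
  qed
  then show ?thesis unfolding u_triangular_def by (intro bchoice ballI)
qed

text \<open>Undoing the exponential turns an eigenvector of \<open>H1\<close> into a homogeneous superpolynomial with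
  the same top degree component \<open>e \<Lambda>\<close>.\<close>

lemma Em_unique:
  assumes eig: "H1_eigen N \<beta> \<omega> b" and tri: "u_triangular N e b" and L: "\<Lambda> \<in> superpartitions N"
  shows "b \<Lambda> = Em (e \<Lambda>)"
proof -
  obtain y where y: "b \<Lambda> = e \<Lambda> + (\<Sum>\<Omega> | \<Omega> \<in> superpartitions N \<and> \<Omega> <\<^sub>u \<Lambda>. scale (y \<Omega>) (e \<Omega>))"
    using tri L unfolding u_triangular_def by blast
  define r where "r = (\<Sum>\<Omega> | \<Omega> \<in> superpartitions N \<and> \<Omega> <\<^sub>u \<Lambda>. scale (y \<Omega>) (e \<Omega>))"
  have below: "f \<in> degrees_in {..<degree \<Lambda>}"
    if "f \<in> degrees_in D" "\<And>d. d \<in> D \<Longrightarrow> d < degree \<Lambda>" for f D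
    using that degrees_in_mono[of D "{..<degree \<Lambda>}"] by auto
  have r: "r \<in> degrees_in {..<degree \<Lambda>}"
    unfolding r_def
  proof (intro superpoly.subspace_sum superpoly.subspace_scale subspace_degrees_in)
    fix \<Omega> assume "\<Omega> \<in> {\<Omega>. \<Omega> \<in> superpartitions N \<and> \<Omega> <\<^sub>u \<Lambda>}"
    then show "e \<Omega> \<in> degrees_in {..<degree \<Lambda>}"
      by (intro below[OF e_props(3)]) (auto simp: u_less_iff)
  qed
  have rV: "r \<in> sym_superpolys N"
    unfolding r_def
    by (intro superpoly.subspace_sum superpoly.subspace_scale subspace_sym_superpolys)
      (auto intro: e_props)
  define g where "g = Ep (b \<Lambda>)"
  have "b \<Lambda> \<in> sym_superpolys N"
    unfolding y r_def[symmetric]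
    by (intro superpoly.subspace_add subspace_sym_superpolys e_props L rV)
  then have gV: "g \<in> superpolys N"
    using exp_Laplacian_sym_superpolys unfolding g_def sym_superpolys_def by blast
  have "Em (coefwise (x_euler N) g) = scale (of_nat (degree \<Lambda>)) (b \<Lambda>)"
    using eig L by (simp add: H1_eigen_def H1_def g_def)
  then have "coefwise (x_euler N) g = scale (of_nat (degree \<Lambda>)) g"
    unfolding g_def by (metis Ep_Em superpoly.linear_scale[OF linear_exp_Laplacian])
  then have gd: "g \<in> degrees_in {degree \<Lambda>}" by (rule x_euler_eigen_degrees_in[OF gV])
  have "g - e \<Lambda> = (Ep (e \<Lambda>) - e \<Lambda>) + Ep r"
    by (simp add: g_def y r_def[symmetric] superpoly.linear_add[OF linear_exp_Laplacian])
  also have "\<dots> \<in> degrees_in {..<degree \<Lambda>}"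
    by (intro superpoly.subspace_add subspace_degrees_in exp_Laplacian_degrees_below r
        below[OF exp_Laplacian_minus_id[OF e_props(3)[OF L]]]) auto
  finally have "g - e \<Lambda> \<in> degrees_in {..<degree \<Lambda>}" .
  moreover have "g - e \<Lambda> \<in> degrees_in {degree \<Lambda>}"
    by (intro superpoly.subspace_diff subspace_degrees_in gd e_props L)
  ultimately have "g - e \<Lambda> \<in> degrees_in {}"
    by (auto simp: degrees_in_def x_graded_def)
  then have "g = e \<Lambda>" by (simp add: degrees_in_empty)
  then show ?thesis using Em_Ep[of "b \<Lambda>"] by (simp add: g_def)
qed

end

end

theorem theorem12:
  fixes N \<beta> :: nat and \<omega> :: real
  assumes "N \<ge> 1" and "\<beta> \<ge> 1" and "\<omega> > 0"
  shows "(is_basis N (m_omega N \<beta> \<omega>) \<and>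
          H1_eigen N \<beta> \<omega> (m_omega N \<beta> \<omega>) \<and>
          u_triangular N (m_super N) (m_omega N \<beta> \<omega>) \<and>
          (\<forall>b. is_basis N b \<and> H1_eigen N \<beta> \<omega> b \<and> u_triangular N (m_super N) b \<longrightarrow>
               (\<forall>\<Lambda>\<in>superpartitions N. b \<Lambda> = m_omega N \<beta> \<omega> \<Lambda>))) \<and>
         (is_basis N (p_omega N \<beta> \<omega>) \<and>
          H1_eigen N \<beta> \<omega> (p_omega N \<beta> \<omega>) \<and>
          u_triangular N (p_super N) (p_omega N \<beta> \<omega>) \<and>
          (\<forall>b. is_basis N b \<and> H1_eigen N \<beta> \<omega> b \<and> u_triangular N (p_super N) b \<longrightarrow>
               (\<forall>\<Lambda>\<in>superpartitions N. b \<Lambda> = p_omega N \<beta> \<omega> \<Lambda>)))"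
proof -
  note m = triangular_family_m_super[of N] and p = triangular_family_p_super[of N]
  show ?thesis
    unfolding m_omega_def[abs_def] p_omega_def[abs_def]
    by (intro conjI is_basis_Em H1_eigen_Em u_triangular_Em m p allI impI ballI)
      (elim conjE, intro Em_unique[OF m] Em_unique[OF p]; assumption)+
qed

end
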